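(* Let $F$ be a connected graph with $e(F)>v(F)$. Then $D_\kappa(F)\ge \frac{e(F)}{v(F)}+2$.
   Context: Graphs are finite simple graphs; $v(F)$ and $e(F)$ denote the numbers of vertices and edges. A graph is $k$-connected if it has more than $k$ vertices, is connected, and remains connected after removal of any $k-1$ vertices; $\kappa(G)$ is the maximum $k$ such that $G$ is $k$-connected. We use first-order logic of graphs with relation symbols for adjacency and equality only. $D_\kappa(F)$ is the minimum quantifier depth of a first-order sentence $\Phi$ for which there is an integer $k$ such that for every connected graph $G$ with $\kappa(G)\ge k$, $G\models\Phi$ if and only if $G$ contains a (not necessarily induced) subgraph isomorphic to $F$. *)

theory Defs
  imports Complex_Main
begin

definition graph :: "'a set \<Rightarrow> ('a \<Rightarrow> 'a \<Rightarrow> bool) \<Rightarrow> bool" where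
  "graph V E \<longleftrightarrow> finite V \<and> (\<forall>x y. E x y \<longrightarrow> x \<in> V \<and> y \<in> V)
     \<and> (\<forall>x y. E x y \<longrightarrow> E y x) \<and> (\<forall>x. \<not> E x x)"

definition num_vertices :: "'a set \<Rightarrow> nat" where
  "num_vertices V = card V"

definition num_edges :: "'a set \<Rightarrow> ('a \<Rightarrow> 'a \<Rightarrow> bool) \<Rightarrow> nat" where
  "num_edges V E = card {{x, y} | x y. x \<in> V \<and> y \<in> V \<and> E x y}"

definition connected_graph :: "'a set \<Rightarrow> ('a \<Rightarrow> 'a \<Rightarrow> bool) \<Rightarrow> bool" where
  "connected_graph V E \<longleftrightarrow> V \<noteq> {} \<and>
     (\<forall>u\<in>V. \<forall>v\<in>V. (\<lambda>x y. x \<in> V \<and> y \<in> V \<and> E x y)\<^sup>*\<^sup>* u v)"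

definition k_connected :: "'a set \<Rightarrow> ('a \<Rightarrow> 'a \<Rightarrow> bool) \<Rightarrow> nat \<Rightarrow> bool" where
  "k_connected V E k \<longleftrightarrow> card V > k \<and> connected_graph V E \<and>
     (\<forall>S. S \<subseteq> V \<and> card S + 1 \<le> k \<longrightarrow> connected_graph (V - S) E)"

definition kappa :: "'a set \<Rightarrow> ('a \<Rightarrow> 'a \<Rightarrow> bool) \<Rightarrow> nat" where
  "kappa V E = (GREATEST k. k_connected V E k)"

definition contains_subgraph ::
  "'b set \<Rightarrow> ('b \<Rightarrow> 'b \<Rightarrow> bool) \<Rightarrow> 'a set \<Rightarrow> ('a \<Rightarrow> 'a \<Rightarrow> bool) \<Rightarrow> bool" where
  "contains_subgraph VG EG VF EF \<longleftrightarrow>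
     (\<exists>f. inj_on f VF \<and> f ` VF \<subseteq> VG \<and> (\<forall>x y. EF x y \<longrightarrow> EG (f x) (f y)))"

datatype fo =
    Adj nat nat
  | Eq nat nat
  | Neg fo
  | Conj fo fo
  | Disj fo fo
  | Impl fo fo
  | Ex nat fo
  | All nat fo

fun free_vars :: "fo \<Rightarrow> nat set" where
  "free_vars (Adj i j) = {i, j}"
| "free_vars (Eq i j) = {i, j}"
| "free_vars (Neg \<phi>) = free_vars \<phi>"
| "free_vars (Conj \<phi> \<psi>) = free_vars \<phi> \<union> free_vars \<psi>"
| "free_vars (Disj \<phi> \<psi>) = free_vars \<phi> \<union> free_vars \<psi>"
| "free_vars (Impl \<phi> \<psi>) = free_vars \<phi> \<union> free_vars \<psi>"
| "free_vars (Ex x \<phi>) = free_vars \<phi> - {x}"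
| "free_vars (All x \<phi>) = free_vars \<phi> - {x}"

definition sentence :: "fo \<Rightarrow> bool" where
  "sentence \<phi> \<longleftrightarrow> free_vars \<phi> = {}"

fun qdepth :: "fo \<Rightarrow> nat" where
  "qdepth (Adj i j) = 0"
| "qdepth (Eq i j) = 0"
| "qdepth (Neg \<phi>) = qdepth \<phi>"
| "qdepth (Conj \<phi> \<psi>) = max (qdepth \<phi>) (qdepth \<psi>)"
| "qdepth (Disj \<phi> \<psi>) = max (qdepth \<phi>) (qdepth \<psi>)"
| "qdepth (Impl \<phi> \<psi>) = max (qdepth \<phi>) (qdepth \<psi>)"
| "qdepth (Ex x \<phi>) = Suc (qdepth \<phi>)"
| "qdepth (All x \<phi>) = Suc (qdepth \<phi>)"

fun sat :: "'a set \<Rightarrow> ('a \<Rightarrow> 'a \<Rightarrow> bool) \<Rightarrow> (nat \<Rightarrow> 'a) \<Rightarrow> fo \<Rightarrow> bool" where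
  "sat V E a (Adj i j) = E (a i) (a j)"
| "sat V E a (Eq i j) = (a i = a j)"
| "sat V E a (Neg \<phi>) = (\<not> sat V E a \<phi>)"
| "sat V E a (Conj \<phi> \<psi>) = (sat V E a \<phi> \<and> sat V E a \<psi>)"
| "sat V E a (Disj \<phi> \<psi>) = (sat V E a \<phi> \<or> sat V E a \<psi>)"
| "sat V E a (Impl \<phi> \<psi>) = (sat V E a \<phi> \<longrightarrow> sat V E a \<psi>)"
| "sat V E a (Ex x \<phi>) = (\<exists>v\<in>V. sat V E (a(x := v)) \<phi>)"
| "sat V E a (All x \<phi>) = (\<forall>v\<in>V. sat V E (a(x := v)) \<phi>)"

text \<open>Truth of a sentence in a graph (independent of the assignment).\<close>
definition models :: "'a set \<Rightarrow> ('a \<Rightarrow> 'a \<Rightarrow> bool) \<Rightarrow> fo \<Rightarrow> bool" where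
  "models V E \<phi> \<longleftrightarrow> (\<forall>a. sat V E a \<phi>)"

text \<open>Phi defines F-subgraph containment on connected graphs of connectivity at
least k. Graphs G range over all finite simple graphs, represented (up to
isomorphism) with vertices in nat.\<close>

definition defines_containment_kappa ::
  "'a set \<Rightarrow> ('a \<Rightarrow> 'a \<Rightarrow> bool) \<Rightarrow> fo \<Rightarrow> nat \<Rightarrow> bool" where
  "defines_containment_kappa VF EF \<Phi> k \<longleftrightarrow> sentence \<Phi> \<and>
     (\<forall>(V :: nat set) E. graph V E \<and> connected_graph V E \<and> kappa V E \<ge> k \<longrightarrow>
        (models V E \<Phi> \<longleftrightarrow> contains_subgraph V E VF EF))"

definition D_kappa :: "'a set \<Rightarrow> ('a \<Rightarrow> 'a \<Rightarrow> bool) \<Rightarrow> nat" where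
  "D_kappa VF EF = (LEAST d. \<exists>\<Phi> k. qdepth \<Phi> = d \<and> defines_containment_kappa VF EF \<Phi> k)"

end

theory Submission
  imports Defs
begin

text \<open>
  Let \<open>m \<ge> 1\<close> be the largest integer with \<open>m < e(F) / v(F)\<close>. We produce two highly connected graphs
  that satisfy the same sentences of quantifier depth \<open>m + 2\<close>, only one of which contains \<open>F\<close>.

  The first is a random graph \<open>H\<close> whose edge probability is slightly above \<open>n powr (- 1 / m)\<close>. In it
  any \<open>m\<close> vertices have common neighbours avoiding any bounded number of prescribed vertices, any
  \<open>m - 1\<close> vertices have a triangle in their common neighbourhood, and every \<open>u\<close> vertices with \<open>u\<close>
  bounded span at most \<open>m * u\<close> edges; hence \<open>F\<close> does not occur. The second is \<open>H\<close> with a copy of \<open>F\<close>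
  planted on arbitrary vertices.

  Duplicator wins the game with \<open>m + 2\<close> rounds by maintaining a partial isomorphism which, on \<open>m\<close>
  vertices, also preserves whether their common neighbourhood contains an edge and, on \<open>m + 1\<close>
  vertices, whether they have a common neighbour. All other extensions needed for the remaining
  moves exist outside the planted copy.
\<close>

section \<open>Ehrenfeucht games\<close>

text \<open>Allow a budget of \<open>m\<close> edges for every new vertex. A common neighbour of
  \<open>m\<close> vertices, and a triangle over \<open>m - 1\<close> vertices (\<open>3 * m\<close>
  edges for three vertices), stay within the budget, so \<open>H\<close> can have them everywhere. A
  common neighbour of \<open>m + 1\<close> vertices (\<open>m + 1\<close> edges for one vertex) and
  an edge over \<open>m\<close> vertices (\<open>2 * m + 1\<close> edges for two) exceed it by one,
  so they occur over some tuples and not over others; these are the two facts that Duplicator has to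
  track. The edge probability \<open>p\<close> sits just above the threshold:
  \<open>n * p ^ m\<close> grows, but so slowly that \<open>p * (n * p ^ m) ^ R\<close> tends to 0
  for the required \<open>R\<close>, and this makes the budget binding on all sets of at most
  \<open>R\<close> vertices.

  Sparseness is used twice. It excludes \<open>F\<close>, and it also yields the replies that must
  lack a common neighbour or a common edge. The second argument is deterministic and adds only
  vertices outside the planted set, so it covers \<open>H\<close> both with and without the copy of
  \<open>F\<close>.\<close>

definition common_nbr :: "('a \<Rightarrow> 'a \<Rightarrow> bool) \<Rightarrow> 'a set \<Rightarrow> bool" where
  "common_nbr E X \<longleftrightarrow> (\<exists>z. \<forall>x\<in>X. E x z)"

definition common_edge :: "('a \<Rightarrow> 'a \<Rightarrow> bool) \<Rightarrow> 'a set \<Rightarrow> bool" where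
  "common_edge E X \<longleftrightarrow> (\<exists>y z. E y z \<and> (\<forall>x\<in>X. E x y \<and> E x z))"

definition pattern :: "('a \<Rightarrow> 'a \<Rightarrow> bool) \<Rightarrow> 'a set \<Rightarrow> 'a set \<Rightarrow> 'a \<Rightarrow> bool" where
  "pattern E A B z \<longleftrightarrow> (\<forall>x\<in>A. E x z) \<and> (\<forall>x\<in>B. \<not> E x z)"

text \<open>Each hypothesis is a reply that Duplicator needs at the corresponding size of the
  position. \<open>ext_nbr\<close> leaves out \<open>A = X\<close>: such a \<open>y\<close> and a
  common neighbour of it with \<open>X\<close> would form an edge over \<open>X\<close>, and by
  \<open>ext_no_edge\<close> not every \<open>m\<close> vertices have one.\<close>

locale rich =
  fixes V :: "'a set" and E :: "'a \<Rightarrow> 'a \<Rightarrow> bool" and m :: nat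
  assumes graph: "graph V E" and m_pos: "m \<ge> 1"
    and ext: "\<And>A B. \<lbrakk>A \<subseteq> V; B \<subseteq> V; A \<inter> B = {}; card A \<le> m; card (A \<union> B) \<le> m + 1\<rbrakk>
      \<Longrightarrow> \<exists>z\<in>V - (A \<union> B). pattern E A B z"
    and ext_no_nbr: "\<And>X A. \<lbrakk>X \<subseteq> V; card X = m; A \<subseteq> X\<rbrakk>
      \<Longrightarrow> \<exists>y\<in>V - X. pattern E A (X - A) y \<and> \<not> common_nbr E (insert y X)"
    and ext_nbr: "\<And>X A. \<lbrakk>X \<subseteq> V; card X = m; A \<subset> X\<rbrakk>
      \<Longrightarrow> \<exists>y\<in>V - X. pattern E A (X - A) y \<and> common_nbr E (insert y X)"
    and ext_no_edge: "\<And>X A. \<lbrakk>X \<subseteq> V; Suc (card X) = m; A \<subseteq> X\<rbrakk>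
      \<Longrightarrow> \<exists>w\<in>V - X. pattern E A (X - A) w \<and> \<not> common_edge E (insert w X)"
    and ext_edge: "\<And>X A. \<lbrakk>X \<subseteq> V; Suc (card X) = m; A \<subseteq> X\<rbrakk>
      \<Longrightarrow> \<exists>w\<in>V - X. pattern E A (X - A) w \<and> common_edge E (insert w X)"

text \<open>A position of size \<open>m\<close> leaves two rounds, enough for Spoiler to play an
  edge inside the common neighbourhood; size \<open>m + 1\<close> leaves one round, enough to play a
  common neighbour. At smaller sizes \<open>rich\<close> offers both outcomes, so nothing has to be
  remembered.\<close>

definition position ::
  "'a set \<Rightarrow> ('a \<Rightarrow> 'a \<Rightarrow> bool) \<Rightarrow> 'b set \<Rightarrow> ('b \<Rightarrow> 'b \<Rightarrow> bool) \<Rightarrow> nat \<Rightarrow> ('a \<times> 'b) set \<Rightarrow> bool" where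
  "position V E V' E' m L \<longleftrightarrow> finite L \<and> L \<subseteq> V \<times> V'
     \<and> (\<forall>u u' w w'. (u, u') \<in> L \<longrightarrow> (w, w') \<in> L \<longrightarrow> (u = w \<longleftrightarrow> u' = w') \<and> (E u w \<longleftrightarrow> E' u' w'))
     \<and> (card L = m \<longrightarrow> (common_edge E (fst ` L) \<longleftrightarrow> common_edge E' (snd ` L)))
     \<and> (card L = m + 1 \<longrightarrow> (common_nbr E (fst ` L) \<longleftrightarrow> common_nbr E' (snd ` L)))"

lemma position_converse:
  assumes "position V E V' E' m L"
  shows "position V' E' V E m (L\<inverse>)"
proof -
  have "fst ` (L\<inverse>) = snd ` L" "snd ` (L\<inverse>) = fst ` L"
    by force+
  then show ?thesis
    using assms unfolding position_def by auto
qed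

lemma position_forth:
  assumes G: "rich V E m" and G': "rich V' E' m"
    and L: "position V E V' E' m L" and c: "card L \<le> m + 1" and v: "v \<in> V"
  shows "\<exists>v'\<in>V'. position V E V' E' m (insert (v, v') L)"
proof (cases "v \<in> fst ` L")
  case True
  then obtain v' where "(v, v') \<in> L" by force
  moreover have "v' \<in> V'" using L \<open>(v, v') \<in> L\<close> unfolding position_def by blast
  ultimately show ?thesis using L by (metis insert_absorb)
next
  case False
  interpret G: rich V E m by fact
  interpret G': rich V' E' m by fact
  define X where "X = fst ` L"
  define X' where "X' = snd ` L"
  define A where "A = snd ` {(u, u') \<in> L. E u v}"
  have fin: "finite L" and sub: "L \<subseteq> V \<times> V'" using L unfolding position_def by auto
  have iso: "(u = w \<longleftrightarrow> u' = w') \<and> (E u w \<longleftrightarrow> E' u' w')" if "(u, u') \<in> L" "(w, w') \<in> L" for u u' w w'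
    using L that unfolding position_def by blast
  have XV: "X \<subseteq> V" "X' \<subseteq> V'" "A \<subseteq> X'" using sub unfolding X_def X'_def A_def by force+
  have finX: "finite X'" using fin X'_def by simp
  have cX: "card X = card L" unfolding X_def using iso by (intro card_image inj_onI) force
  have cX': "card X' = card L" unfolding X'_def using iso by (intro card_image inj_onI) force
  have symE: "E x y \<Longrightarrow> E y x" and irr: "\<not> E x x" and EV: "E x y \<Longrightarrow> x \<in> V \<and> y \<in> V" for x y
    using G.graph unfolding graph_def by blast+
  have symE': "E' x y \<Longrightarrow> E' y x" and irr': "\<not> E' x x" and EV': "E' x y \<Longrightarrow> x \<in> V' \<and> y \<in> V'" for x y
    using G'.graph unfolding graph_def by blast+
  have A_iff: "u' \<in> A \<longleftrightarrow> E u v" if "(u, u') \<in> L" for u u'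
    using iso that unfolding A_def by force
  have cA: "card A \<le> card L" using XV(3) finX cX' card_mono by metis
  have full: "A = X' \<longleftrightarrow> (\<forall>x\<in>X. E x v)"
    using A_iff XV(3) unfolding X_def X'_def by (auto simp: image_iff) (metis snd_conv subset_iff)+
  have main: "\<exists>y\<in>V' - X'. pattern E' A (X' - A) y
     \<and> (Suc (card L) = m \<longrightarrow> (common_edge E (insert v X) \<longleftrightarrow> common_edge E' (insert y X')))
     \<and> (Suc (card L) = m + 1 \<longrightarrow> (common_nbr E (insert v X) \<longleftrightarrow> common_nbr E' (insert y X')))"
  proof -
    have plain: "\<exists>y\<in>V' - X'. pattern E' A (X' - A) y" if "card A \<le> m"
    proof -
      have eq: "A \<union> (X' - A) = X'" using XV by blast
      show ?thesis using G'.ext[of A "X' - A"] XV that cX' c eq by auto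
    qed
    \<comment> \<open>The reply must also meet the condition attached to the next size
      \<open>Suc (card L)\<close>, hence the split at \<open>m - 1\<close>, \<open>m\<close> and
      \<open>m + 1\<close>.\<close>
    consider "Suc (card L) < m" | "Suc (card L) = m" | "card L = m" | "card L = m + 1"
      using c by linarith
    then show ?thesis
    proof cases
      case 1
      then show ?thesis using plain cA by auto
    next
      case 2
      show ?thesis
        using G'.ext_edge[OF XV(2) _ XV(3)] G'.ext_no_edge[OF XV(2) _ XV(3)] cX' 2 by auto
    next
      case 3
      show ?thesis
      proof (cases "common_nbr E (insert v X)")
        case False
        then show ?thesis using G'.ext_no_nbr[OF XV(2) _ XV(3)] cX' 3 by auto
      next
        case True
        show ?thesis
        proof (cases "A = X'")
          case False
          then show ?thesis using G'.ext_nbr[OF XV(2), of A] XV(3) cX' 3 True by auto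
        next
          case AX: True
          \<comment> \<open>The one reply that \<open>rich\<close> does not supply: \<open>v\<close>
            and \<open>z\<close> form an edge over \<open>X\<close>, the condition stored at size
            \<open>m\<close> transfers it, and one end of the transferred edge is the reply.\<close>
          obtain z where "E v z" "\<forall>x\<in>X. E x z" using True unfolding common_nbr_def by auto
          moreover have "\<forall>x\<in>X. E x v" using AX full by simp
          ultimately have "common_edge E X" unfolding common_edge_def by blast
          then have "common_edge E' X'" using L 3 unfolding position_def X_def X'_def by blast
          then obtain y z where yz: "E' y z" "\<forall>x\<in>X'. E' x y \<and> E' x z"
            unfolding common_edge_def by blast
          have "y \<notin> X'" using yz irr' by blast
          moreover have "common_nbr E' (insert y X')" using yz unfolding common_nbr_def by blast
          ultimately show ?thesis using yz True AX EV' 3 unfolding pattern_def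
            by (intro bexI[of _ y]) auto
        qed
      qed
    next
      case 4
      show ?thesis
      proof (cases "A = X'")
        case False
        \<comment> \<open>With \<open>A\<close> a proper subset of \<open>X'\<close>, at most
          \<open>m\<close> adjacencies are requested, so plain extension applies. Only a vertex
          joined to all of \<open>X'\<close> needs the stored condition.\<close>
        then have "card A < card X'" using XV(3) finX by (meson psubsetI psubset_card_mono)
        then show ?thesis using plain 4 cX' by auto
      next
        case True
        then have "common_nbr E X" using full unfolding common_nbr_def by blast
        then have "common_nbr E' X'" using L 4 unfolding position_def X_def X'_def by blast
        then obtain y where y: "\<forall>x\<in>X'. E' x y" unfolding common_nbr_def by blast
        have "X' \<noteq> {}" using cX' 4 by auto
        then have "y \<in> V'" using y EV' by blast
        moreover have "y \<notin> X'" using y irr' by blast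
        ultimately show ?thesis using y True 4 unfolding pattern_def by auto
      qed
    qed
  qed
  then obtain y where y: "y \<in> V'" "y \<notin> X'" "pattern E' A (X' - A) y"
     "Suc (card L) = m \<longrightarrow> (common_edge E (insert v X) \<longleftrightarrow> common_edge E' (insert y X'))"
     "Suc (card L) = m + 1 \<longrightarrow> (common_nbr E (insert v X) \<longleftrightarrow> common_nbr E' (insert y X'))"
    by blast
  have cins: "card (insert (v, y) L) = Suc (card L)"
    using False fin by (metis card_insert_disjoint fst_conv image_eqI)
  have new: "E u v \<longleftrightarrow> E' u' y" "u \<noteq> v" "u' \<noteq> y" if "(u, u') \<in> L" for u u'
  proof -
    have "u' \<in> X'" "u \<in> X" using that unfolding X'_def X_def by force+
    then show "E u v \<longleftrightarrow> E' u' y" "u \<noteq> v" "u' \<noteq> y"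
      using A_iff[OF that] y False unfolding pattern_def X_def by auto
  qed
  have "position V E V' E' m (insert (v, y) L)"
    unfolding position_def cins
  proof (intro conjI allI impI)
    fix u u' w w' assume *: "(u, u') \<in> insert (v, y) L" "(w, w') \<in> insert (v, y) L"
    show "(u = w) = (u' = w')" using * iso new by blast
    show "E u w = E' u' w'" 
    proof (cases "(u, u') = (v, y)"; cases "(w, w') = (v, y)")
      assume "(u, u') = (v, y)" "(w, w') \<noteq> (v, y)"
      then show ?thesis using * new(1)[of w w'] symE symE' by auto
    qed (use * iso new irr irr' in auto)
  qed (use fin sub v y X_def X'_def in auto)
  then show ?thesis using y by blast
qed

lemma position_back:
  assumes "rich V E m" and "rich V' E' m"
    and "position V E V' E' m L" and "card L \<le> m + 1" and "v' \<in> V'"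
  shows "\<exists>v\<in>V. position V E V' E' m (insert (v, v') L)"
proof -
  obtain v where v: "v \<in> V" "position V' E' V E m (insert (v', v) (L\<inverse>))"
    using position_forth[OF assms(2,1) position_converse[OF assms(3)] _ assms(5)] assms(4) by auto
  have "(insert (v', v) (L\<inverse>))\<inverse> = insert (v, v') L" by auto
  then show ?thesis using v position_converse by metis
qed

text \<open>Each quantifier costs one round and adds at most one pair, so the bound on
  \<open>card L + qdepth \<phi>\<close> survives every step of the induction.\<close>

lemma sat_position:
  assumes "rich V E m" and "rich V' E' m"
    and "position V E V' E' m L" and "card L + qdepth \<phi> \<le> m + 2"
    and "\<And>x. x \<in> free_vars \<phi> \<Longrightarrow> (a x, b x) \<in> L"
  shows "sat V E a \<phi> \<longleftrightarrow> sat V' E' b \<phi>"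
  using assms(3-)
proof (induction \<phi> arbitrary: a b L)
  case (Adj i j)
  then show ?case unfolding position_def by (auto 4 3)
next
  case (Eq i j)
  then show ?case unfolding position_def by (auto 4 3)
next
  case (Neg \<phi>)
  from Neg.IH[of L a b] Neg.prems show ?case by simp
next
  case (Conj \<phi>1 \<phi>2)
  from Conj.IH(1)[of L a b] Conj.IH(2)[of L a b] Conj.prems show ?case by simp
next
  case (Disj \<phi>1 \<phi>2)
  from Disj.IH(1)[of L a b] Disj.IH(2)[of L a b] Disj.prems show ?case by simp
next
  case (Impl \<phi>1 \<phi>2)
  from Impl.IH(1)[of L a b] Impl.IH(2)[of L a b] Impl.prems show ?case by simp
next
  case (Ex x \<phi>)
  have c: "card L \<le> m + 1" using Ex.prems by simp
  have step: "sat V E (a(x := v)) \<phi> \<longleftrightarrow> sat V' E' (b(x := v')) \<phi>"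
    if "position V E V' E' m (insert (v, v') L)" for v v'
  proof (rule Ex.IH[OF that])
    have "finite L" using Ex.prems unfolding position_def by blast
    then show "card (insert (v, v') L) + qdepth \<phi> \<le> m + 2"
      using Ex.prems by (simp add: card_insert_if)
  qed (use Ex.prems in auto)
  show ?case
    using position_forth[OF assms(1,2) Ex.prems(1) c] position_back[OF assms(1,2) Ex.prems(1) c] step
    by (metis sat.simps(7))
next
  case (All x \<phi>)
  have c: "card L \<le> m + 1" using All.prems by simp
  have step: "sat V E (a(x := v)) \<phi> \<longleftrightarrow> sat V' E' (b(x := v')) \<phi>"
    if "position V E V' E' m (insert (v, v') L)" for v v'
  proof (rule All.IH[OF that])
    have "finite L" using All.prems unfolding position_def by blast
    then show "card (insert (v, v') L) + qdepth \<phi> \<le> m + 2"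
      using All.prems by (simp add: card_insert_if)
  qed (use All.prems in auto)
  show ?case
    using position_forth[OF assms(1,2) All.prems(1) c] position_back[OF assms(1,2) All.prems(1) c] step
    by (metis sat.simps(8))
qed

lemma rich_equivalent:
  assumes "rich V E m" and "rich V' E' m" and "sentence \<Phi>" and "qdepth \<Phi> \<le> m + 2"
  shows "models V E \<Phi> \<longleftrightarrow> models V' E' \<Phi>"
proof -
  interpret rich V E m by fact
  have "position V E V' E' m {}"
    using m_pos unfolding position_def by auto
  then have "sat V E a \<Phi> \<longleftrightarrow> sat V' E' b \<Phi>" for a b
    using sat_position[OF assms(1,2), of "{}" \<Phi> a b] assms(3,4) unfolding sentence_def by simp
  then show ?thesis unfolding models_def by blast
qed

section \<open>Planting edges in a sparse graph\<close>

lemma finite_edge_set: "finite U \<Longrightarrow> finite {{x, y} |x y. x \<in> U \<and> y \<in> U \<and> E x y}"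
  by (rule finite_subset[of _ "Pow U"]) auto

lemma num_edges_insert:
  assumes "finite U" "y \<notin> U" "A \<subseteq> U" "\<And>x. x \<in> A \<Longrightarrow> E x y"
  shows "num_edges U E + card A \<le> num_edges (insert y U) E"
proof -
  let ?S = "\<lambda>U. {{x, z} |x z. x \<in> U \<and> z \<in> U \<and> E x z}"
  let ?T = "(\<lambda>x. {x, y}) ` A"
  have "card ?T = card A"
    using assms by (intro card_image inj_onI) (auto simp: doubleton_eq_iff)
  moreover have "?S U \<inter> ?T = {}" using assms(2) by (auto simp: doubleton_eq_iff)
  moreover have "finite ?T" using assms finite_subset by blast
  ultimately have "card (?S U \<union> ?T) = num_edges U E + card A"
    unfolding num_edges_def using finite_edge_set[OF assms(1)] by (subst card_Un_disjoint) auto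
  moreover have "?S U \<subseteq> ?S (insert y U)" by blast
  moreover have "?T \<subseteq> ?S (insert y U)"
  proof
    fix e assume "e \<in> ?T"
    then obtain x where "x \<in> A" "e = {x, y}" by blast
    then show "e \<in> ?S (insert y U)" using assms(3) assms(4)[of x]
      by (intro CollectI exI[of _ x] exI[of _ y]) auto
  qed
  ultimately have le: "?S U \<union> ?T \<subseteq> ?S (insert y U)" and eq: "card (?S U \<union> ?T) = num_edges U E + card A"
    by auto
  have "card (?S U \<union> ?T) \<le> num_edges (insert y U) E"
    unfolding num_edges_def using le finite_edge_set[of "insert y U" E] assms(1) by (intro card_mono) auto
  then show ?thesis using eq by simp
qed

text \<open>\<open>s\<close> bounds the number of vertices to be avoided, \<open>R\<close> the size
  of the sets known to be sparse; \<open>R \<le> s\<close> lets a whole such set be avoided at once.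
  The triangle is a separate hypothesis because building it by \<open>ext\<close> would require
  \<open>m + 1\<close> adjacencies from its last vertex.\<close>

locale robust =
  fixes V :: "'a set" and E :: "'a \<Rightarrow> 'a \<Rightarrow> bool" and m s R :: nat
  assumes graph: "graph V E" and m_pos: "m \<ge> 1" and R_le_s: "R \<le> s"
    and ext: "\<And>A B. \<lbrakk>A \<subseteq> V; B \<subseteq> V; A \<inter> B = {}; card A \<le> m; card B \<le> s\<rbrakk>
      \<Longrightarrow> \<exists>z\<in>V - (A \<union> B). pattern E A B z"
    and triangle: "\<And>X B. \<lbrakk>X \<subseteq> V; B \<subseteq> V; X \<inter> B = {}; Suc (card X) = m; card B \<le> s\<rbrakk>
      \<Longrightarrow> \<exists>w\<in>V - (X \<union> B). \<exists>y\<in>V - (X \<union> B). \<exists>z\<in>V - (X \<union> B).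
            E w y \<and> E w z \<and> E y z \<and> pattern E X B w \<and> pattern E X B y \<and> pattern E X B z"
    and sparse: "\<And>U. \<lbrakk>U \<subseteq> V; card U \<le> R\<rbrakk> \<Longrightarrow> num_edges U E \<le> m * card U"
begin

lemma finV: "finite V" and sym: "E x y \<Longrightarrow> E y x" and irr: "\<not> E x x"
  and EV: "E x y \<Longrightarrow> x \<in> V \<and> y \<in> V"
  using graph unfolding graph_def by blast+

text \<open>The difference of \<open>num_edges U E\<close> and \<open>m * card U\<close> starts at
  \<open>- m * u\<close> or more and gains at least 1 per step. After \<open>m * u + 1\<close> steps
  it is positive, although the set still has at most \<open>u + 3 * (m * u + 1)\<close> vertices and
  is therefore sparse.\<close>

lemma no_growth:
  assumes "U0 \<subseteq> V" "card U0 \<le> u" "u + 3 * (m * u + 1) \<le> R"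
    and step: "\<And>U. \<lbrakk>U0 \<subseteq> U; U \<subseteq> V; card U \<le> R\<rbrakk> \<Longrightarrow> \<exists>U'. U \<subseteq> U' \<and> U' \<subseteq> V \<and> card U' \<le> card U + 3
        \<and> num_edges U E + m * (card U' - card U) + 1 \<le> num_edges U' E"
  shows False
proof -
  have "i \<le> m * u + 1 \<Longrightarrow> \<exists>U. U0 \<subseteq> U \<and> U \<subseteq> V \<and> card U \<le> u + 3 * i
      \<and> m * card U + i \<le> num_edges U E + m * u" for i
  proof (induction i)
    case 0
    have "m * card U0 \<le> num_edges U0 E + m * u"
      using mult_le_mono2[OF assms(2), of m] by linarith
    then show ?case using assms(1,2) by (intro exI[of _ U0]) simp
  next
    case (Suc i)
    then obtain U where U: "U0 \<subseteq> U" "U \<subseteq> V" "card U \<le> u + 3 * i"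
      "m * card U + i \<le> num_edges U E + m * u" by auto
    have "3 * i \<le> 3 * (m * u + 1)" using Suc.prems by (intro mult_le_mono2) linarith
    then have "card U \<le> R" using U(3) assms(3) by linarith
    from step[OF U(1,2) this] obtain U' where U': "U \<subseteq> U'" "U' \<subseteq> V" "card U' \<le> card U + 3"
      "num_edges U E + m * (card U' - card U) + 1 \<le> num_edges U' E" by blast
    have "card U \<le> card U'" using U' finV by (meson card_mono finite_subset)
    then have "m * card U' = m * card U + m * (card U' - card U)"
      by (metis add_mult_distrib2 le_add_diff_inverse)
    then show ?case using U U' by (intro exI[of _ U']) auto
  qed
  from this[of "m * u + 1"] obtain U where U: "U \<subseteq> V" "card U \<le> u + 3 * (m * u + 1)"
      "m * card U + (m * u + 1) \<le> num_edges U E + m * u" by auto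
  have "num_edges U E \<le> m * card U" using sparse[OF U(1)] U(2) assms(3) by linarith
  then show False using U(3) by linarith
qed

text \<open>The pads fill up a prescribed neighbour set to exactly \<open>m\<close> vertices, so
  that a new vertex joined to it brings \<open>m\<close> edges. Having no edges to \<open>Z\<close>
  or among themselves, they cannot be common neighbours of a nonempty part of
  \<open>Z\<close>.\<close>

lemma independent_pads:
  assumes "Z \<subseteq> V" "card Z + j \<le> s"
  shows "\<exists>P\<subseteq>V. card P = j \<and> P \<inter> Z = {} \<and> (\<forall>p\<in>P. \<forall>x\<in>Z \<union> P. \<not> E x p)"
  using assms(2)
proof (induction j)
  case (Suc j)
  then obtain P where P: "P \<subseteq> V" "card P = j" "P \<inter> Z = {}" "\<forall>p\<in>P. \<forall>x\<in>Z \<union> P. \<not> E x p"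
    by auto
  have "card (Z \<union> P) \<le> s" using card_Un_le[of Z P] Suc.prems P(2) by linarith
  then obtain z where z: "z \<in> V - (Z \<union> P)" "pattern E {} (Z \<union> P) z"
    using ext[of "{}" "Z \<union> P"] assms P by auto
  have "finite P" using P finV finite_subset by blast
  then have "card (insert z P) = Suc j" using z P by auto
  moreover have "\<forall>p\<in>insert z P. \<forall>x\<in>Z \<union> insert z P. \<not> E x p"
  proof (intro ballI)
    fix p x assume "p \<in> insert z P" "x \<in> Z \<union> insert z P"
    then show "\<not> E x p"
      using z(2) P(4) irr[of z] sym[of x p] unfolding pattern_def by blast
  qed
  moreover have "insert z P \<subseteq> V" "insert z P \<inter> Z = {}" using z(1) P(1,3) by auto
  ultimately show ?case by blast
qed (auto intro: exI[of _ "{}"])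

text \<open>In the next lemma the two negative extension properties follow from sparseness alone: if
  every candidate vertex failed, then candidates together with the witnesses of their failure could
  be collected one after the other, each time adding more than \<open>m\<close> edges per new vertex.\<close>

lemma rich_superposition:
  assumes graph': "graph V E'" and W: "W \<subseteq> V" "card W \<le> v"
    and sub: "\<And>x y. E x y \<Longrightarrow> E' x y" and sup: "\<And>x y. E' x y \<Longrightarrow> E x y \<or> x \<in> W \<and> y \<in> W"
    and R: "(v + 2 * m) + 3 * (m * (v + 2 * m) + 1) \<le> R"
  shows "rich V E' m"
proof
  have irr': "\<not> E' x x" and sym': "E' x y \<Longrightarrow> E' y x" and EV': "E' x y \<Longrightarrow> x \<in> V \<and> y \<in> V" for x y
    using graph' unfolding graph_def by blast+
  have fin: "finite U" if "U \<subseteq> V" for U using that finV finite_subset by blast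
  have same: "E' x y \<longleftrightarrow> E x y" "E' y x \<longleftrightarrow> E y x" if "y \<notin> W" for x y
    using that sub sup by blast+
  \<comment> \<open>Adding \<open>W - A\<close> to the vertices to be avoided forces
    \<open>z\<close> out of \<open>W\<close>, where \<open>E\<close> and \<open>E'\<close>
    agree.\<close>
  have ext': "\<exists>z\<in>V - (A \<union> B \<union> W). pattern E A B z \<and> pattern E' A B z \<and> (\<forall>x\<in>W-A. \<not> E x z)"
    if AB: "A \<subseteq> V" "B \<subseteq> V" "A \<inter> B = {}" "card A \<le> m" "card B + v \<le> s" for A B
  proof -
    have "card (B \<union> (W - A)) \<le> s"
      using card_Un_le[of B "W - A"] card_mono[of W "W - A"] fin[OF W(1)] W(2) AB(5) by auto
    moreover have "B \<union> (W - A) \<subseteq> V" "A \<inter> (B \<union> (W - A)) = {}" using AB W by auto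
    ultimately obtain z where z: "z \<in> V - (A \<union> (B \<union> (W - A)))" "pattern E A (B \<union> (W - A)) z"
      using ext[of A "B \<union> (W - A)"] AB by blast
    show ?thesis
    proof (cases "z \<in> W")
      case True then show ?thesis using z by blast
    next
      case False
      then have "E' x z \<longleftrightarrow> E x z" for x by (rule same)
      then show ?thesis using z False by (intro bexI[of _ z]) (auto simp: pattern_def)
    qed
  qed
  show "graph V E'" "1 \<le> m" by fact+ (rule m_pos)
  have small: "x \<le> 2 * m + 4 \<Longrightarrow> x + v \<le> s" for x
  proof -
    assume x: "x \<le> 2 * m + 4"
    define K where "K = m * (v + 2 * m)"
    have "v + 2 * m \<le> K" unfolding K_def using m_pos by (cases m) auto
    then show "x + v \<le> s" using R R_le_s m_pos x unfolding K_def[symmetric] by simp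
  qed
  show "\<exists>z\<in>V - (A \<union> B). pattern E' A B z"
    if "A \<subseteq> V" "B \<subseteq> V" "A \<inter> B = {}" "card A \<le> m" "card (A \<union> B) \<le> m + 1" for A B
  proof -
    have "card B \<le> card (A \<union> B)" using that fin by (meson Un_upper2 card_mono Un_least)
    then show ?thesis using ext'[of A B] that small[of "card B"] by fastforce
  qed
  show "\<exists>y\<in>V - X. pattern E' A (X - A) y \<and> common_nbr E' (insert y X)"
    if X: "X \<subseteq> V" "card X = m" "A \<subset> X" for X A
  proof -
    \<comment> \<open>The common neighbour \<open>z\<close> is fixed first. As \<open>A\<close> is a
      proper subset of \<open>X\<close>, \<open>insert z A\<close> has at most \<open>m\<close>
      elements and \<open>y\<close> can be joined to all of it.\<close>
    obtain z where z: "z \<in> V" "z \<notin> X" "z \<notin> W" "pattern E' X {} z"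
      using ext'[of X "{}"] X small[of 0] by auto
    have A: "card A < m" using X fin by (metis psubset_card_mono)
    have "finite A" using X fin by blast
    then have "card (insert z A) \<le> m" using A by (simp add: card_insert_if)
    moreover have "card (X - A) \<le> m" using X fin by (metis Diff_subset card_mono)
    ultimately obtain y where y: "y \<in> V" "y \<notin> insert z A" "y \<notin> X - A" "pattern E' (insert z A) (X - A) y"
      using ext'[of "insert z A" "X - A"] X z small[of "card (X - A)"] by auto
    have "common_nbr E' (insert y X)"
      using y z sym' unfolding common_nbr_def pattern_def by blast
    then show ?thesis using y X unfolding pattern_def by blast
  qed
  show "\<exists>w\<in>V - X. pattern E' A (X - A) w \<and> common_edge E' (insert w X)"
    if X: "X \<subseteq> V" "Suc (card X) = m" "A \<subseteq> X" for X A
  proof (cases "A = X")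
    case True
    have "card (W - X) \<le> s" using card_mono[of W "W - X"] fin[OF W(1)] W(2) small[of 0] by auto
    moreover have "W - X \<subseteq> V" "X \<inter> (W - X) = {}" using W by auto
    ultimately obtain w y z where wyz: "w \<in> V - (X \<union> (W - X))" "y \<in> V - (X \<union> (W - X))" "z \<in> V - (X \<union> (W - X))"
      "E w y" "E w z" "E y z" "pattern E X (W - X) w" "pattern E X (W - X) y" "pattern E X (W - X) z"
      using triangle[of X "W - X"] X(1,2) by metis
    have "common_edge E' (insert w X)"
      unfolding common_edge_def using wyz sub by (intro exI[of _ y] exI[of _ z]) (auto simp: pattern_def)
    moreover have "pattern E' X {} w" using wyz(7) sub by (auto simp: pattern_def)
    ultimately show ?thesis using wyz True by auto
  next
    case False
    obtain y where y: "y \<in> V" "y \<notin> X" "y \<notin> W" "pattern E' X {} y"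
      using ext'[of X "{}"] X small[of 0] by auto
    have fX: "finite X" using X fin by blast
    have "card (insert y X) \<le> m" using X fX by (simp add: card_insert_if)
    then obtain z where z: "z \<in> V" "z \<notin> insert y X" "z \<notin> W" "pattern E' (insert y X) {} z"
      using ext'[of "insert y X" "{}"] X y small[of 0] by auto
    \<comment> \<open>Now \<open>A\<close> has at most \<open>m - 2\<close> elements, so
      \<open>w\<close> can be joined to \<open>A\<close> and to both ends of the edge without
      exceeding \<open>m\<close> adjacencies.\<close>
    have "card A < card X" using X fX False by (meson psubsetI psubset_card_mono)
    moreover have "finite A" using X fX finite_subset by blast
    ultimately have "card (insert z (insert y A)) \<le> m" using X by (simp add: card_insert_if)
    moreover have "card (X - A) \<le> m" using X fX by (metis Diff_subset card_mono le_SucI)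
    ultimately obtain w where w: "w \<in> V" "w \<notin> insert z (insert y A)" "w \<notin> X - A"
        "pattern E' (insert z (insert y A)) (X - A) w"
      using ext'[of "insert z (insert y A)" "X - A"] X y z small[of "card (X - A)"] by auto
    have "common_edge E' (insert w X)"
      unfolding common_edge_def using w(4) y(4) z(4) sym'[of _ w]
      by (intro exI[of _ y] exI[of _ z]) (auto simp: pattern_def)
    then show ?thesis using w X unfolding pattern_def by blast
  qed
  have pads: "\<exists>P\<subseteq>V. card (A \<union> P) = m \<and> card P \<le> m \<and> P \<inter> (W \<union> X) = {} \<and> (\<forall>p\<in>P. \<forall>x\<in>W \<union> X \<union> P. \<not> E x p)"
    if X: "X \<subseteq> V" "card X \<le> m" "A \<subseteq> X" for X A
  proof -
    have "finite A" using X fin by blast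
    moreover have "card A \<le> m" using X fin by (meson card_mono le_trans)
    moreover have "card (W \<union> X) + (m - card A) \<le> s"
      using card_Un_le[of W X] W(2) X(2) small[of "2 * m"] by linarith
    then obtain P where P: "P\<subseteq>V" "card P = m - card A" "P \<inter> (W \<union> X) = {}"
        "\<forall>p\<in>P. \<forall>x\<in>W \<union> X \<union> P. \<not> E x p"
      using independent_pads[of "W \<union> X" "m - card A"] X W by auto
    moreover have "finite P" using P fin by blast
    moreover have "A \<inter> P = {}" using P X by blast
    ultimately have "card (A \<union> P) = m" by (simp add: card_Un_disjoint)
    then show ?thesis using P by (intro exI[of _ P]) auto
  qed
  have cand: "\<exists>y\<in>V - U. pattern E A (U - A) y" if "A \<subseteq> U" "U \<subseteq> V" "card U \<le> R" "card A = m" for A U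
  proof -
    have "card (U - A) \<le> card U" using fin[OF that(2)] by (intro card_mono) auto
    then have "\<exists>y\<in>V - (A \<union> (U - A)). pattern E A (U - A) y"
      using that R_le_s by (intro ext) auto
    moreover have "A \<union> (U - A) = U" using that by blast
    ultimately show ?thesis by simp
  qed
  \<comment> \<open>The starting set has at most \<open>v\<close> vertices from \<open>W\<close> and
    at most \<open>m\<close> each from \<open>X\<close> and from the pads \<open>P\<close>.\<close>
  have cU0: "W \<union> X \<union> P \<subseteq> V \<and> card (W \<union> X \<union> P) \<le> v + 2 * m"
    if "X \<subseteq> V" "card X \<le> m" "P \<subseteq> V" "card P \<le> m" for X P
    using that W card_Un_le[of "W \<union> X" P] card_Un_le[of W X] by auto
  show "\<exists>y\<in>V - X. pattern E' A (X - A) y \<and> \<not> common_nbr E' (insert y X)"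
    if X: "X \<subseteq> V" "card X = m" "A \<subseteq> X" for X A
  proof (rule ccontr)
    assume neg: "\<not> ?thesis"
    obtain P where P: "P \<subseteq> V" "card (A \<union> P) = m" "card P \<le> m" "P \<inter> (W \<union> X) = {}"
       "\<forall>p\<in>P. \<forall>x\<in>W \<union> X \<union> P. \<not> E x p"
      using pads[of X A] X by auto
    show False
    \<comment> \<open>Since \<open>W\<close> lies in the starting set, every vertex added later is
      outside \<open>W\<close>, and its edges in \<open>E'\<close> are edges of \<open>E\<close>.
      The candidate \<open>y\<close> brings \<open>m\<close> edges and its common neighbour
      \<open>z\<close> with \<open>X\<close> brings \<open>m + 1\<close>, in all
      \<open>2 * m + 1\<close> for two vertices.\<close>
    proof (rule no_growth[of "W \<union> X \<union> P", OF _ _ R])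
      show "W \<union> X \<union> P \<subseteq> V" "card (W \<union> X \<union> P) \<le> v + 2 * m" using cU0 X P by auto
      fix U assume U: "W \<union> X \<union> P \<subseteq> U" "U \<subseteq> V" "card U \<le> R"
      have fU: "finite U" using U fin by blast
      have APU: "A \<union> P \<subseteq> U" using X U by blast
      obtain y where y: "y \<in> V" "y \<notin> U" "pattern E (A \<union> P) (U - (A \<union> P)) y"
        using cand[OF APU U(2,3) P(2)] by blast
      have yW: "y \<notin> W" using y U by blast
      have "pattern E' A (X - A) y"
        using y(3) U P(4) X by (auto simp: pattern_def same[OF yW])
      then have "common_nbr E' (insert y X)" using neg y U by blast
      then obtain z where z: "E' y z" "\<forall>x\<in>X. E' x z" unfolding common_nbr_def by blast
      have Eyz: "E y z" using z same(2)[OF yW] by simp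
      have "z \<notin> U - (A \<union> P)" using y(3) sym[OF Eyz] unfolding pattern_def by blast
      moreover have "z \<notin> A" using z irr' X by blast
      \<comment> \<open>A pad has no edge to \<open>X\<close>, and \<open>X\<close> is nonempty
        because \<open>m \<ge> 1\<close>.\<close>
      moreover have "z \<notin> P"
      proof
        assume "z \<in> P"
        moreover have "X \<noteq> {}" using X m_pos by auto
        then obtain x where "x \<in> X" by blast
        moreover have "z \<notin> W" using \<open>z \<in> P\<close> P(4) by blast
        ultimately show False using z P(5) same(1)[of z] by blast
      qed
      ultimately have zU: "z \<notin> U" by blast
      have zy: "z \<noteq> y" using Eyz irr by blast
      have Exz: "E x z" if "x \<in> X" for x
      proof -
        have "z \<notin> W" using zU U by blast
        then show ?thesis using z that same(1)[of z x] by simp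
      qed
      have "num_edges U E + m \<le> num_edges (insert y U) E"
        using num_edges_insert[OF fU y(2) APU, of E] y(3) P(2) unfolding pattern_def by auto
      moreover have "num_edges (insert y U) E + card (insert y X) \<le> num_edges (insert z (insert y U)) E"
        using Exz Eyz zU zy X U fU by (intro num_edges_insert) auto
      moreover have "card (insert y X) = m + 1"
      proof -
        have "y \<notin> X" using y U by blast
        then show ?thesis using X fin[OF X(1)] by simp
      qed
      moreover have "card (insert z (insert y U)) = card U + 2" using fU zU zy y by simp
      moreover have "insert z (insert y U) \<subseteq> V" using EV[OF Eyz] U by blast
      ultimately show "\<exists>U'. U \<subseteq> U' \<and> U' \<subseteq> V \<and> card U' \<le> card U + 3
        \<and> num_edges U E + m * (card U' - card U) + 1 \<le> num_edges U' E"
        by (intro exI[of _ "insert z (insert y U)"]) (simp add: subset_insertI2 algebra_simps)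
    qed
  qed
  show "\<exists>w\<in>V - X. pattern E' A (X - A) w \<and> \<not> common_edge E' (insert w X)"
    if X: "X \<subseteq> V" "Suc (card X) = m" "A \<subseteq> X" for X A
  proof (rule ccontr)
    assume neg: "\<not> ?thesis"
    obtain P where P: "P \<subseteq> V" "card (A \<union> P) = m" "card P \<le> m" "P \<inter> (W \<union> X) = {}"
       "\<forall>p\<in>P. \<forall>x\<in>W \<union> X \<union> P. \<not> E x p"
      using pads[of X A] X by auto
    show False
    proof (rule no_growth[of "W \<union> X \<union> P", OF _ _ R])
      show "W \<union> X \<union> P \<subseteq> V" "card (W \<union> X \<union> P) \<le> v + 2 * m" using cU0 X P by auto
      fix U assume U: "W \<union> X \<union> P \<subseteq> U" "U \<subseteq> V" "card U \<le> R"
      have fU: "finite U" using U fin by blast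
      have APU: "A \<union> P \<subseteq> U" using X U by blast
      obtain w where w: "w \<in> V" "w \<notin> U" "pattern E (A \<union> P) (U - (A \<union> P)) w"
        using cand[OF APU U(2,3) P(2)] by blast
      have wW: "w \<notin> W" using w U by blast
      have wX: "w \<notin> X" using w U by blast
      have "pattern E' A (X - A) w"
        using w(3) U P(4) X by (auto simp: pattern_def same[OF wW])
      then have "common_edge E' (insert w X)" using neg w U by blast
      then obtain y z where yz: "E' y z" "\<forall>x\<in>insert w X. E' x y \<and> E' x z"
        unfolding common_edge_def by blast
      have loc: "u \<notin> W \<and> E w u \<and> (u \<in> P \<or> u \<notin> U) \<and> (\<forall>x\<in>X. E x u) \<and> u \<noteq> w" if "\<forall>x\<in>insert w X. E' x u" for u
      proof -
        have wu: "E w u" using that same(2)[OF wW] by simp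
        have "u \<notin> U - (A \<union> P)" using w(3) sym[OF wu] unfolding pattern_def by blast
        moreover have "u \<notin> A" using that irr' X by blast
        ultimately have "u \<in> P \<or> u \<notin> U" by blast
        moreover from this have "u \<notin> W" using P U by blast
        moreover from this have "\<forall>x\<in>X. E x u" using that same(1)[of u] by simp
        ultimately show ?thesis using wu irr by blast
      qed
      have Ly: "y \<notin> W" "E w y" "y \<in> P \<or> y \<notin> U" "\<forall>x\<in>X. E x y" "y \<noteq> w" using loc[of y] yz by auto
      have Lz: "z \<notin> W" "E w z" "z \<in> P \<or> z \<notin> U" "\<forall>x\<in>X. E x z" "z \<noteq> w" using loc[of z] yz by auto
      have Eyz: "E y z" using yz same(2)[OF Ly(1)] by simp
      have "y \<noteq> z" using Eyz irr by blast
      have e1: "num_edges U E + m \<le> num_edges (insert w U) E"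
        using num_edges_insert[OF fU w(2) APU, of E] w(3) P(2) unfolding pattern_def by auto
      have last: "num_edges U' E + (m + 1) \<le> num_edges (insert b U') E"
        if "finite U'" "insert w U \<subseteq> U'" "a \<in> U'" "b \<notin> U'" "a \<notin> insert w X" "E a b" "E w b" "\<forall>x\<in>X. E x b" for U' a b
      proof -
        have "card (insert a (insert w X)) = m + 1" using that wX X fin[OF X(1)] by simp
        moreover have "num_edges U' E + card (insert a (insert w X)) \<le> num_edges (insert b U') E"
          using that U by (intro num_edges_insert) auto
        ultimately show ?thesis by simp
      qed
      have notX: "a \<notin> X" if "a \<in> P \<or> a \<notin> U" for a using that P(4) U by blast
      have inV: "y \<in> V" "z \<in> V" using EV Eyz by blast+
      \<comment> \<open>For \<open>m = 1\<close> the set \<open>X\<close> is empty, so a pad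
        \<open>a\<close> may be an end of the common edge. Then \<open>w\<close> brings
        \<open>m\<close> edges, and the other end \<open>b\<close>, joined to \<open>a\<close>,
        \<open>w\<close> and \<open>X\<close>, brings \<open>m + 1\<close>.\<close>
      have one_pad: "\<exists>U'. U \<subseteq> U' \<and> U' \<subseteq> V \<and> card U' \<le> card U + 3
            \<and> num_edges U E + m * (card U' - card U) + 1 \<le> num_edges U' E"
        if "a \<in> P" "b \<notin> U" "E a b" "E w b" "\<forall>x\<in>X. E x b" "b \<noteq> w" "a \<noteq> w" "b \<in> V" for a b
      proof -
        have "num_edges (insert w U) E + (m + 1) \<le> num_edges (insert b (insert w U)) E"
          using that U w fU notX by (intro last[of _ a b]) auto
        moreover have "card (insert b (insert w U)) = card U + 2" using that fU w by simp
        ultimately show ?thesis using e1 that U w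
          by (intro exI[of _ "insert b (insert w U)"]) (simp add: subset_insertI2 algebra_simps)
      qed
      show "\<exists>U'. U \<subseteq> U' \<and> U' \<subseteq> V \<and> card U' \<le> card U + 3
        \<and> num_edges U E + m * (card U' - card U) + 1 \<le> num_edges U' E"
      proof (cases "y \<in> P"; cases "z \<in> P")
        assume "y \<in> P" "z \<in> P" then show ?thesis using Eyz P(5) by blast
      next
        assume "y \<in> P" "z \<notin> P" then show ?thesis using one_pad[OF _ _ Eyz Lz(2,4,5) Ly(5) inV(2)] Lz(3) by simp
      next
        assume "y \<notin> P" "z \<in> P" then show ?thesis using one_pad[OF _ _ sym[OF Eyz] Ly(2,4,5) Lz(5) inV(1)] Ly(3) by simp
      next
        assume "y \<notin> P" "z \<notin> P"
        \<comment> \<open>Here three vertices are new: \<open>w\<close> and \<open>y\<close> bring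
          \<open>m\<close> edges each and \<open>z\<close> brings \<open>m + 1\<close>. This case is
          the origin of the 3 in \<open>no_growth\<close>.\<close>
        then have new: "y \<notin> U" "z \<notin> U" using Ly Lz by auto
        have "num_edges (insert w U) E + card (insert w X) \<le> num_edges (insert y (insert w U)) E"
          using Ly new U fU by (intro num_edges_insert) auto
        moreover have "card (insert w X) = m" using wX X fin[OF X(1)] by simp
        moreover have "num_edges (insert y (insert w U)) E + (m + 1) \<le> num_edges (insert z (insert y (insert w U))) E"
          using new Ly Lz Eyz \<open>y \<noteq> z\<close> fU notX by (intro last[of _ y z]) auto
        moreover have "card (insert z (insert y (insert w U))) = card U + 3"
          using new fU w Ly Lz \<open>y \<noteq> z\<close> by simp
        ultimately show ?thesis using e1 U w inV
          by (intro exI[of _ "insert z (insert y (insert w U))"]) (simp add: subset_insertI2 algebra_simps)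
      qed
    qed
  qed
qed

end

section \<open>Bernoulli random subsets\<close>

locale bernoulli_subset =
  fixes p :: real
  assumes p0: "0 \<le> p" and p1: "p \<le> 1"
begin

definition wt :: "'e set \<Rightarrow> 'e set \<Rightarrow> real" where
  "wt I S = p ^ card S * (1 - p) ^ card (I - S)"

text \<open>Probability as a finite weighted sum. The ground set \<open>I\<close> is a parameter so
  that parts of it can be exposed one after the other within the same calculus.\<close>

definition pr :: "'e set \<Rightarrow> ('e set \<Rightarrow> bool) \<Rightarrow> real" where
  "pr I Q = (\<Sum>S\<in>Pow I. wt I S * of_bool (Q S))"

lemma wt_nonneg: "wt I S \<ge> 0"
  unfolding wt_def using p0 p1 by simp

lemma pr_nonneg: "pr I Q \<ge> 0"
  unfolding pr_def by (intro sum_nonneg mult_nonneg_nonneg wt_nonneg) simp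

lemma pr_mono:
  assumes "\<And>S. S \<subseteq> I \<Longrightarrow> Q S \<Longrightarrow> Q' S"
  shows "pr I Q \<le> pr I Q'"
  unfolding pr_def by (intro sum_mono mult_left_mono wt_nonneg) (use assms in auto)

lemma pr_cong:
  assumes "\<And>S. S \<subseteq> I \<Longrightarrow> Q S = Q' S"
  shows "pr I Q = pr I Q'"
  using assms by (intro antisym pr_mono) auto

text \<open>Exposes \<open>I\<close> before \<open>J\<close>; independence and conditioning below
  are both read off from this identity.\<close>

lemma pr_Un:
  assumes "finite I" "finite J" "I \<inter> J = {}"
  shows "pr (I \<union> J) Q = (\<Sum>S\<in>Pow I. wt I S * pr J (\<lambda>T. Q (S \<union> T)))"
proof -
  have "pr (I \<union> J) Q = (\<Sum>(S, T)\<in>Pow I \<times> Pow J. wt (I \<union> J) (S \<union> T) * of_bool (Q (S \<union> T)))"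
    unfolding pr_def
  proof (rule sum.reindex_bij_witness[of _ "\<lambda>(S, T). S \<union> T" "\<lambda>S. (S \<inter> I, S \<inter> J)"])
    fix S assume "S \<in> Pow (I \<union> J)"
    then have "S \<inter> I \<union> S \<inter> J = S" by blast
    then show "(case (S \<inter> I, S \<inter> J) of (S, T) \<Rightarrow> S \<union> T) = S"
      and "(case (S \<inter> I, S \<inter> J) of (S, T) \<Rightarrow> wt (I \<union> J) (S \<union> T) * of_bool (Q (S \<union> T)))
        = wt (I \<union> J) S * of_bool (Q S)" by simp_all
    show "(S \<inter> I, S \<inter> J) \<in> Pow I \<times> Pow J" by simp
  next
    fix P assume "P \<in> Pow I \<times> Pow J"
    then obtain S T where P: "P = (S, T)" "S \<subseteq> I" "T \<subseteq> J" by auto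
    then have "(S \<union> T) \<inter> I = S" "(S \<union> T) \<inter> J = T" using assms(3) by auto
    then show "((case P of (S, T) \<Rightarrow> S \<union> T) \<inter> I, (case P of (S, T) \<Rightarrow> S \<union> T) \<inter> J) = P"
      using P by simp
    show "(case P of (S, T) \<Rightarrow> S \<union> T) \<in> Pow (I \<union> J)" using P by auto
  qed
  also have "\<dots> = (\<Sum>(S, T)\<in>Pow I \<times> Pow J. wt I S * (wt J T * of_bool (Q (S \<union> T))))"
  proof (intro sum.cong refl, clarify)
    fix S T assume *: "S \<subseteq> I" "T \<subseteq> J"
    have "card (S \<union> T) = card S + card T"
      using * assms by (intro card_Un_disjoint) (auto intro: finite_subset)
    moreover have "I \<union> J - (S \<union> T) = (I - S) \<union> (J - T)" using * assms(3) by blast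
    moreover have "card ((I - S) \<union> (J - T)) = card (I - S) + card (J - T)"
      using * assms by (intro card_Un_disjoint) auto
    ultimately show "wt (I \<union> J) (S \<union> T) * of_bool (Q (S \<union> T)) = wt I S * (wt J T * of_bool (Q (S \<union> T)))"
      unfolding wt_def by (simp add: power_add)
  qed
  finally show ?thesis
    unfolding pr_def by (simp add: sum.cartesian_product sum_distrib_left)
qed

lemma pr_True:
  assumes "finite I"
  shows "pr I (\<lambda>_. True) = 1"
  using assms
proof (induction I)
  case empty
  then show ?case unfolding pr_def wt_def by simp
next
  case (insert x I)
  have "pr (I \<union> {x}) (\<lambda>_. True) = (\<Sum>S\<in>Pow I. wt I S * pr {x} (\<lambda>_. True))"
    using insert by (intro pr_Un) auto
  moreover have "pr {x} (\<lambda>_. True) = 1"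
    unfolding pr_def wt_def by (simp add: Pow_insert)
  ultimately show ?case using insert unfolding pr_def by simp
qed

lemma sum_wt: "finite I \<Longrightarrow> (\<Sum>S\<in>Pow I. wt I S) = 1"
  using pr_True[of I] unfolding pr_def by simp

lemma pr_not:
  assumes "finite I"
  shows "pr I (\<lambda>S. \<not> Q S) = 1 - pr I Q"
proof -
  have "pr I (\<lambda>S. \<not> Q S) + pr I Q = (\<Sum>S\<in>Pow I. wt I S)"
    unfolding pr_def sum.distrib[symmetric] by (intro sum.cong) auto
  then show ?thesis using sum_wt[OF assms] by simp
qed

lemma pr_less_1_exists:
  assumes "finite I" "pr I Q < 1"
  shows "\<exists>S\<subseteq>I. \<not> Q S"
proof (rule ccontr)
  assume "\<not> ?thesis"
  then have "pr I Q = pr I (\<lambda>_. True)" by (intro pr_cong) auto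
  then show False using assms(2) pr_True[OF assms(1)] by simp
qed

lemma pr_disj: "pr I (\<lambda>S. Q S \<or> Q' S) \<le> pr I Q + pr I Q'"
proof -
  have "wt I S * of_bool (Q S \<or> Q' S) \<le> wt I S * of_bool (Q S) + wt I S * of_bool (Q' S)" for S
    using wt_nonneg[of I S] by auto
  then show ?thesis unfolding pr_def sum.distrib[symmetric] by (intro sum_mono)
qed

lemma pr_Bex:
  assumes "finite K"
  shows "pr I (\<lambda>S. \<exists>k\<in>K. Q k S) \<le> (\<Sum>k\<in>K. pr I (Q k))"
  using assms
proof (induction K)
  case empty
  then show ?case unfolding pr_def by simp
next
  case (insert k K)
  have "pr I (\<lambda>S. \<exists>k\<in>insert k K. Q k S) = pr I (\<lambda>S. Q k S \<or> (\<exists>k\<in>K. Q k S))"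
    by (rule pr_cong) auto
  also have "\<dots> \<le> pr I (Q k) + pr I (\<lambda>S. \<exists>k\<in>K. Q k S)" by (rule pr_disj)
  finally show ?case using insert by simp
qed

lemma pr_Bex_le:
  assumes "finite K" "\<And>k. k \<in> K \<Longrightarrow> pr I (Q k) \<le> \<epsilon>" "real (card K) \<le> c" "0 \<le> \<epsilon>"
  shows "pr I (\<lambda>S. \<exists>k\<in>K. Q k S) \<le> c * \<epsilon>"
proof -
  have "pr I (\<lambda>S. \<exists>k\<in>K. Q k S) \<le> (\<Sum>k\<in>K. pr I (Q k))" by (rule pr_Bex[OF assms(1)])
  also have "\<dots> \<le> (\<Sum>k\<in>K. \<epsilon>)" by (rule sum_mono[OF assms(2)])
  also have "\<dots> = card K * \<epsilon>" by simp
  also have "\<dots> \<le> c * \<epsilon>" by (rule mult_right_mono[OF assms(3,4)])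
  finally show ?thesis .
qed

lemma pr_indep:
  assumes "finite I" "finite J" "I \<inter> J = {}"
  shows "pr (I \<union> J) (\<lambda>S. Q (S \<inter> I) \<and> Q' (S \<inter> J)) = pr I Q * pr J Q'"
proof -
  have "pr (I \<union> J) (\<lambda>S. Q (S \<inter> I) \<and> Q' (S \<inter> J))
      = (\<Sum>S\<in>Pow I. wt I S * pr J (\<lambda>T. Q ((S \<union> T) \<inter> I) \<and> Q' ((S \<union> T) \<inter> J)))"
    by (rule pr_Un[OF assms])
  also have "\<dots> = (\<Sum>S\<in>Pow I. wt I S * of_bool (Q S) * pr J Q')"
  proof (intro sum.cong refl)
    fix S assume S: "S \<in> Pow I"
    have "(S \<union> T) \<inter> I = S" "(S \<union> T) \<inter> J = T" if "T \<subseteq> J" for T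
      using S that assms(3) by auto
    then have "pr J (\<lambda>T. Q ((S \<union> T) \<inter> I) \<and> Q' ((S \<union> T) \<inter> J)) = pr J (\<lambda>T. Q S \<and> Q' T)"
      by (intro pr_cong) simp
    also have "\<dots> = of_bool (Q S) * pr J Q'"
      unfolding pr_def by (cases "Q S") auto
    finally show "wt I S * pr J (\<lambda>T. Q ((S \<union> T) \<inter> I) \<and> Q' ((S \<union> T) \<inter> J))
        = wt I S * of_bool (Q S) * pr J Q'" by simp
  qed
  also have "\<dots> = pr I Q * pr J Q'" unfolding pr_def[of I] by (simp add: sum_distrib_right)
  finally show ?thesis .
qed

lemma pr_restrict:
  assumes "finite I" "J \<subseteq> I"
  shows "pr I (\<lambda>S. Q (S \<inter> J)) = pr J Q"
proof -
  have "pr (J \<union> (I - J)) (\<lambda>S. Q (S \<inter> J) \<and> True) = pr J Q * pr (I - J) (\<lambda>_. True)"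
    using assms by (intro pr_indep) (auto intro: finite_subset)
  moreover have "J \<union> (I - J) = I" using assms by blast
  moreover have "pr (I - J) (\<lambda>_. True) = 1" using assms(1) by (intro pr_True) simp
  ultimately show ?thesis by simp
qed

lemma pr_conditional:
  assumes "finite I" "finite J" "I \<inter> J = {}" "0 \<le> \<epsilon>"
    and "\<And>S. S \<subseteq> I \<Longrightarrow> Q1 S \<Longrightarrow> pr J (\<lambda>T. Q (S \<union> T)) \<le> \<epsilon>"
  shows "pr (I \<union> J) (\<lambda>S. Q1 (S \<inter> I) \<and> Q S) \<le> \<epsilon>"
proof -
  have "pr (I \<union> J) (\<lambda>S. Q1 (S \<inter> I) \<and> Q S)
      = (\<Sum>S\<in>Pow I. wt I S * pr J (\<lambda>T. Q1 ((S \<union> T) \<inter> I) \<and> Q (S \<union> T)))"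
    by (rule pr_Un[OF assms(1-3)])
  also have "\<dots> \<le> (\<Sum>S\<in>Pow I. wt I S * \<epsilon>)"
  proof (intro sum_mono mult_left_mono wt_nonneg)
    fix S assume S: "S \<in> Pow I"
    have "(S \<union> T) \<inter> I = S" if "T \<subseteq> J" for T using S that assms(3) by auto
    then have "pr J (\<lambda>T. Q1 ((S \<union> T) \<inter> I) \<and> Q (S \<union> T)) = pr J (\<lambda>T. Q1 S \<and> Q (S \<union> T))"
      by (intro pr_cong) simp
    also have "\<dots> \<le> \<epsilon>"
    proof (cases "Q1 S")
      case True then show ?thesis using assms(5)[of S] S by simp
    next
      case False then show ?thesis using assms(4) unfolding pr_def by simp
    qed
    finally show "pr J (\<lambda>T. Q1 ((S \<union> T) \<inter> I) \<and> Q (S \<union> T)) \<le> \<epsilon>" .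
  qed
  also have "\<dots> = \<epsilon>" using sum_wt[OF assms(1)] by (simp add: sum_distrib_right[symmetric])
  finally show ?thesis .
qed

text \<open>Each event reads only its own part \<open>D k\<close> of the ground set; the parts are
  disjoint and are split off one at a time by \<open>pr_indep\<close>.\<close>

lemma pr_Ball_le:
  assumes "finite K" "finite I" "0 \<le> \<epsilon>"
    and "\<And>k. k \<in> K \<Longrightarrow> D k \<subseteq> I"
    and "\<And>k l. k \<in> K \<Longrightarrow> l \<in> K \<Longrightarrow> k \<noteq> l \<Longrightarrow> D k \<inter> D l = {}"
    and "\<And>k. k \<in> K \<Longrightarrow> pr (D k) (Q k) \<le> \<epsilon>"
  shows "pr I (\<lambda>S. \<forall>k\<in>K. Q k (S \<inter> D k)) \<le> \<epsilon> ^ card K"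
  using assms(1,2,4-)
proof (induction K arbitrary: I)
  case empty
  then show ?case using pr_True[of I] by simp
next
  case (insert k K)
  have Dk: "D k \<subseteq> I" "finite (D k)" using insert.prems(1,2) finite_subset[of "D k" I] by auto
  have disj: "D l \<subseteq> I - D k" "D l \<inter> D k = {}" if "l \<in> K" for l
    using insert.prems(2)[of l] insert.prems(3)[of l k] insert.hyps that by auto
  have "pr I (\<lambda>S. \<forall>k\<in>insert k K. Q k (S \<inter> D k))
      = pr (D k \<union> (I - D k)) (\<lambda>S. Q k (S \<inter> D k) \<and> (\<forall>l\<in>K. Q l ((S \<inter> (I - D k)) \<inter> D l)))"
  proof -
    have "D k \<union> (I - D k) = I" using Dk by blast
    moreover have "S \<inter> (I - D k) \<inter> D l = S \<inter> D l" if "l \<in> K" for S l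
      using disj[OF that] by blast
    ultimately show ?thesis by simp
  qed
  also have "\<dots> = pr (D k) (Q k) * pr (I - D k) (\<lambda>S. \<forall>l\<in>K. Q l (S \<inter> D l))"
    using Dk insert.prems(1) by (intro pr_indep) auto
  also have "\<dots> \<le> \<epsilon> * \<epsilon> ^ card K"
  proof (rule mult_mono)
    show "pr (D k) (Q k) \<le> \<epsilon>" using insert.prems(4) by simp
    show "pr (I - D k) (\<lambda>S. \<forall>l\<in>K. Q l (S \<inter> D l)) \<le> \<epsilon> ^ card K"
    proof (rule insert.IH)
      show "D i \<inter> D j = {}" if "i \<in> K" "j \<in> K" "i \<noteq> j" for i j
        using insert.prems(3)[of i j] that by simp
    qed (use insert.prems(1,4) disj(1) in auto)
  qed (use pr_nonneg assms(3) in auto)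
  finally show ?case using insert.hyps by simp
qed

lemma pr_superset:
  assumes "finite I" "F \<subseteq> I"
  shows "pr I (\<lambda>S. F \<subseteq> S) = p ^ card F"
proof -
  have "pr I (\<lambda>S. F \<subseteq> S) = pr I (\<lambda>S. F \<subseteq> S \<inter> F)" by (rule pr_cong) auto
  also have "\<dots> = pr F (\<lambda>S. F \<subseteq> S)" by (rule pr_restrict[OF assms])
  also have "\<dots> = (\<Sum>S\<in>Pow F. if S = F then wt F F else 0)"
    unfolding pr_def by (intro sum.cong) auto
  also have "\<dots> = p ^ card F" using assms finite_subset by (subst sum.delta) (auto simp: wt_def)
  finally show ?thesis .
qed

lemma pr_avoid:
  assumes "finite I" "F \<subseteq> I"
  shows "pr I (\<lambda>S. S \<inter> F = {}) = (1 - p) ^ card F"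
proof -
  have "pr I (\<lambda>S. S \<inter> F = {}) = pr F (\<lambda>S. S = {})" by (rule pr_restrict[OF assms])
  also have "\<dots> = (\<Sum>S\<in>Pow F. if S = {} then wt F {} else 0)"
    unfolding pr_def by (intro sum.cong) auto
  also have "\<dots> = (1 - p) ^ card F" using assms finite_subset by (subst sum.delta) (auto simp: wt_def)
  finally show ?thesis .
qed

lemma pr_pattern:
  assumes "finite I" "F \<subseteq> I" "G \<subseteq> I" "F \<inter> G = {}"
  shows "pr I (\<lambda>S. F \<subseteq> S \<and> S \<inter> G = {}) = p ^ card F * (1 - p) ^ card G"
proof -
  have fin: "finite F" "finite G" using assms finite_subset by blast+
  have "pr I (\<lambda>S. F \<subseteq> S \<and> S \<inter> G = {}) = pr I (\<lambda>S. F \<subseteq> (S \<inter> (F \<union> G)) \<and> (S \<inter> (F \<union> G)) \<inter> G = {})"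
    by (intro pr_cong) auto
  also have "\<dots> = pr (F \<union> G) (\<lambda>S. F \<subseteq> S \<and> S \<inter> G = {})"
    using assms by (intro pr_restrict[where Q = "\<lambda>S. F \<subseteq> S \<and> S \<inter> G = {}"]) auto
  also have "\<dots> = pr (F \<union> G) (\<lambda>S. F \<subseteq> S \<inter> F \<and> (S \<inter> G) \<inter> G = {})" by (intro pr_cong) auto
  also have "\<dots> = pr F (\<lambda>S. F \<subseteq> S) * pr G (\<lambda>S. S \<inter> G = {})"
    by (rule pr_indep[OF fin assms(4)])
  also have "\<dots> = p ^ card F * (1 - p) ^ card G"
    using pr_superset[OF fin(1) subset_refl] pr_avoid[OF fin(2) subset_refl] by simp
  finally show ?thesis .
qed

end

section \<open>Random graphs\<close>

definition pairs :: "'a set \<Rightarrow> 'a set set" where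
  "pairs V = {{x, y} |x y. x \<in> V \<and> y \<in> V \<and> x \<noteq> y}"

definition adj :: "'a set set \<Rightarrow> 'a \<Rightarrow> 'a \<Rightarrow> bool" where
  "adj S x y \<longleftrightarrow> {x, y} \<in> S"

lemma finite_pairs: "finite V \<Longrightarrow> finite (pairs V)"
  unfolding pairs_def by (rule finite_subset[of _ "Pow V"]) auto

lemma pair_in_pairs: "{x, y} \<in> pairs V \<longleftrightarrow> x \<in> V \<and> y \<in> V \<and> x \<noteq> y"
  unfolding pairs_def by (auto simp: doubleton_eq_iff)

lemma card_subsets_le:
  assumes "finite V"
  shows "card {U. U \<subseteq> V \<and> card U = u} \<le> card V ^ u"
proof (cases "u \<le> card V")
  case True
  then show ?thesis using n_subsets[OF assms, of u] binomial_le_pow by simp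
next
  case False
  then show ?thesis using n_subsets[OF assms, of u] by (simp add: binomial_eq_0)
qed

lemma finite_small_subsets: "finite V \<Longrightarrow> finite {U. U \<subseteq> V \<and> P U}"
  by (rule finite_subset[of _ "Pow V"]) auto

lemma card_small_subsets_le:
  assumes "finite V" "V \<noteq> {}"
  shows "card {U. U \<subseteq> V \<and> card U \<le> u} \<le> (u + 1) * card V ^ u"
proof -
  have pos: "card V \<ge> 1" using assms by (simp add: Suc_leI card_gt_0_iff)
  have eq: "{U. U \<subseteq> V \<and> card U \<le> u} = (\<Union>i\<le>u. {U. U \<subseteq> V \<and> card U = i})" by auto
  have "card {U. U \<subseteq> V \<and> card U \<le> u} \<le> (\<Sum>i\<le>u. card {U. U \<subseteq> V \<and> card U = i})"
    unfolding eq by (rule card_UN_le) simp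
  also have "\<dots> \<le> (\<Sum>i\<le>u. card V ^ u)"
  proof (rule sum_mono)
    fix i assume "i \<in> {..u}"
    then show "card {U. U \<subseteq> V \<and> card U = i} \<le> card V ^ u"
      using card_subsets_le[OF assms(1), of i] power_increasing[OF _ pos, of i u] by simp
  qed
  also have "\<dots> = (u + 1) * card V ^ u" by simp
  finally show ?thesis .
qed

context bernoulli_subset
begin

text \<open>Distinct candidates \<open>y\<close> outside \<open>A \<union> B\<close> are decided by
  disjoint sets of pairs, so their failures are independent.\<close>

lemma pr_no_pattern:
  assumes "finite V" "J \<subseteq> V" "A \<subseteq> V" "B \<subseteq> V" "A \<inter> B = {}"
  shows "pr (pairs V) (\<lambda>S. \<not> (\<exists>y\<in>J - (A \<union> B). pattern (adj S) A B y))
    \<le> (1 - p ^ card A * (1 - p) ^ card B) ^ card (J - (A \<union> B))"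
proof -
  define e where "e y = (\<lambda>x. {x, y})" for y :: 'a
  define Q where "Q y S \<longleftrightarrow> \<not> (e y ` A \<subseteq> S \<and> S \<inter> e y ` B = {})" for y S
  define D where "D y = e y ` (A \<union> B)" for y
  have finJ: "finite (J - (A \<union> B))" using assms finite_subset by blast
  have inj: "inj_on (e y) C" for y C unfolding e_def by (auto simp: inj_on_def doubleton_eq_iff)
  have fin: "finite A" "finite B" using assms finite_subset by blast+
  have "pr (pairs V) (\<lambda>S. \<forall>y\<in>J - (A \<union> B). Q y (S \<inter> D y))
    \<le> (1 - p ^ card A * (1 - p) ^ card B) ^ card (J - (A \<union> B))"
  proof (rule pr_Ball_le[OF finJ finite_pairs[OF assms(1)]])
    have "p ^ card A \<le> 1" "(1 - p) ^ card B \<le> 1" using p0 p1 by (simp_all add: power_le_one)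
    then show "0 \<le> 1 - p ^ card A * (1 - p) ^ card B" using p0 p1
      by (simp add: mult_le_one)
  next
    fix y assume y: "y \<in> J - (A \<union> B)"
    show "D y \<subseteq> pairs V"
      unfolding D_def e_def using y assms(2-4) by (auto simp: pair_in_pairs)
    have "pr (D y) (Q y) = 1 - p ^ card (e y ` A) * (1 - p) ^ card (e y ` B)"
    proof -
      have finD: "finite (D y)" unfolding D_def using fin by simp
      have "e y ` A \<inter> e y ` B = {}"
        using inj_on_image_Int[OF inj[of y "A \<union> B"], of A B] assms(5) by simp
      then have "pr (D y) (\<lambda>S. e y ` A \<subseteq> S \<and> S \<inter> e y ` B = {}) = p ^ card (e y ` A) * (1 - p) ^ card (e y ` B)"
        by (intro pr_pattern finD) (auto simp: D_def)
      then show ?thesis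
        unfolding Q_def by (subst pr_not[OF finD]) simp
    qed
    then show "pr (D y) (Q y) \<le> 1 - p ^ card A * (1 - p) ^ card B"
      using card_image[OF inj] by simp
  next
    fix y y' assume *: "y \<in> J - (A \<union> B)" "y' \<in> J - (A \<union> B)" "y \<noteq> y'"
    show "D y \<inter> D y' = {}"
    proof (rule ccontr)
      assume "D y \<inter> D y' \<noteq> {}"
      then obtain x x' where "x \<in> A \<union> B" "x' \<in> A \<union> B" "{x, y} = {x', y'}"
        unfolding D_def e_def by blast
      then show False using * by (auto simp: doubleton_eq_iff)
    qed
  qed
  moreover have "pr (pairs V) (\<lambda>S. \<not> (\<exists>y\<in>J - (A \<union> B). pattern (adj S) A B y))
      \<le> pr (pairs V) (\<lambda>S. \<forall>y\<in>J - (A \<union> B). Q y (S \<inter> D y))"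
  proof (rule pr_mono, rule ballI)
    fix S y assume *: "\<not> (\<exists>y\<in>J - (A \<union> B). pattern (adj S) A B y)" "y \<in> J - (A \<union> B)"
    show "Q y (S \<inter> D y)"
      unfolding Q_def
    proof
      assume "e y ` A \<subseteq> S \<inter> D y \<and> S \<inter> D y \<inter> e y ` B = {}"
      then have "pattern (adj S) A B y" unfolding pattern_def adj_def D_def e_def by blast
      then show False using * by blast
    qed
  qed
  ultimately show ?thesis by linarith
qed

text \<open>The factor 4 is made of two halves: at least half of \<open>J\<close> survives the
  removal of \<open>A \<union> B\<close>, and Bernoulli's inequality gives
  \<open>(1 - p) ^ card B \<ge> 1 / 2\<close>.\<close>

lemma pr_no_pattern_exp:
  assumes "finite V" "J \<subseteq> V" "A \<subseteq> V" "B \<subseteq> V" "A \<inter> B = {}"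
    and "card A \<le> a" "card B \<le> s" "real s * p \<le> 1 / 2" "2 * (a + s) \<le> card J"
    and T: "4 * T \<le> p ^ a * card J"
  shows "pr (pairs V) (\<lambda>S. \<not> (\<exists>y\<in>J - (A \<union> B). pattern (adj S) A B y)) \<le> exp (- T)"
proof -
  define x where "x = p ^ card A * (1 - p) ^ card B"
  have "finite A" "finite B" "finite J" using assms finite_subset by blast+
  then have "card J \<le> card (J - (A \<union> B)) + card (A \<union> B)"
    by (metis add.commute diff_card_le_card_Diff finite_Un le_diff_conv)
  then have "card J \<le> card (J - (A \<union> B)) + (a + s)"
    using card_Un_le[of A B] assms(6,7) by linarith
  then have "card J \<le> 2 * card (J - (A \<union> B))" using assms(9) by simp
  then have k: "real (card J) / 2 \<le> card (J - (A \<union> B))" by linarith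
  have "p ^ card A \<le> 1" "(1 - p) ^ card B \<le> 1" using p0 p1 by (simp_all add: power_le_one)
  then have x1: "x \<le> 1" unfolding x_def using p0 p1 by (simp add: mult_le_one)
  have "1 / 2 \<le> 1 - real (card B) * p"
    using assms(7,8) p0 mult_right_mono[of "real (card B)" "real s" p] by simp
  also have "\<dots> \<le> (1 - p) ^ card B"
    using Bernoulli_inequality[of "- p" "card B"] p1 by simp
  finally have B: "1 / 2 \<le> (1 - p) ^ card B" .
  have "p ^ a \<le> p ^ card A" using p0 p1 assms(6) by (simp add: power_decreasing)
  then have "p ^ a * (1 / 2) \<le> x"
    unfolding x_def using B p0 by (intro mult_mono) auto
  then have "p ^ a * (1 / 2) * (real (card J) / 2) \<le> x * card (J - (A \<union> B))"
    using k p0 by (intro mult_mono) (auto simp: x_def p1)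
  then have "T \<le> x * card (J - (A \<union> B))" using T by simp
  have "pr (pairs V) (\<lambda>S. \<not> (\<exists>y\<in>J - (A \<union> B). pattern (adj S) A B y)) \<le> (1 - x) ^ card (J - (A \<union> B))"
    unfolding x_def by (rule pr_no_pattern[OF assms(1-5)])
  also have "\<dots> \<le> exp (- x) ^ card (J - (A \<union> B))"
    using x1 exp_ge_add_one_self[of "- x"] by (intro power_mono) auto
  also have "\<dots> = exp (- (x * card (J - (A \<union> B))))" by (simp add: exp_of_nat_mult[symmetric] mult.commute)
  also have "\<dots> \<le> exp (- T)" using \<open>T \<le> _\<close> by simp
  finally show ?thesis .
qed

lemma pr_patterns_exp:
  assumes "finite V" "V \<noteq> {}" "finite \<J>" "real s * p \<le> 1 / 2"
    and \<J>: "\<And>J. J \<in> \<J> \<Longrightarrow> J \<subseteq> V \<and> 2 * (a + s) \<le> card J \<and> 4 * T \<le> p ^ a * card J"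
  shows "pr (pairs V) (\<lambda>S. \<exists>A\<in>{A. A \<subseteq> V \<and> card A \<le> a}. \<exists>B\<in>{B. B \<subseteq> V \<and> card B \<le> s}. \<exists>J\<in>\<J>.
      A \<inter> B = {} \<and> \<not> (\<exists>y\<in>J - (A \<union> B). pattern (adj S) A B y))
    \<le> ((a + 1) * card V ^ a) * (((s + 1) * card V ^ s) * (card \<J> * exp (- T)))"
proof (rule pr_Bex_le, goal_cases)
  case (2 A)
  show ?case
  proof (rule pr_Bex_le, goal_cases)
    case (2 B)
    show ?case
    proof (rule pr_Bex_le, goal_cases)
      case (2 J)
      show ?case
      proof (cases "A \<inter> B = {}")
        case True
        then show ?thesis
          using pr_no_pattern_exp[of V J A B a s T] \<J>[OF 2] \<open>A \<in> _\<close> \<open>B \<in> _\<close> assms(1,4) by simp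
      next
        case False
        then show ?thesis unfolding pr_def by simp
      qed
    qed (use assms in auto)
  next
    case 3
    show ?case using card_small_subsets_le[OF assms(1,2), of s] of_nat_mono by fastforce
  qed (use finite_small_subsets[OF assms(1)] in auto)
next
  case 3
  show ?case using card_small_subsets_le[OF assms(1,2), of a] of_nat_mono by fastforce
qed (use finite_small_subsets[OF assms(1)] in auto)

text \<open>The pairs \<open>a y\<close> are exposed first. Unless all of them are absent, failure
  forces the absence of a particular \<open>b y\<close>, which has probability \<open>1 - p\<close>.
  A single \<open>b y\<close> is used because \<open>b\<close> need not be injective: several
  \<open>y\<close> may share a partner.\<close>

lemma pr_no_cherry:
  assumes "finite Y" "inj_on a Y" "a ` Y \<inter> b ` Y = {}"
  shows "pr (a ` Y \<union> b ` Y) (\<lambda>T. \<not> (\<exists>y\<in>Y. a y \<in> T \<and> b y \<in> T)) \<le> 1 - p * (1 - (1 - p) ^ card Y)"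
proof -
  let ?Q = "\<lambda>T. \<not> (\<exists>y\<in>Y. a y \<in> T \<and> b y \<in> T)"
  have fin: "finite (a ` Y)" "finite (b ` Y)" using assms by auto
  have "pr (a ` Y \<union> b ` Y) ?Q = (\<Sum>S\<in>Pow (a ` Y). wt (a ` Y) S * pr (b ` Y) (\<lambda>T. ?Q (S \<union> T)))"
    by (rule pr_Un[OF fin assms(3)])
  also have "\<dots> \<le> (\<Sum>S\<in>Pow (a ` Y). wt (a ` Y) S * ((1 - p) + p * of_bool (S = {})))"
  proof (intro sum_mono mult_left_mono wt_nonneg)
    fix S assume S: "S \<in> Pow (a ` Y)"
    show "pr (b ` Y) (\<lambda>T. ?Q (S \<union> T)) \<le> (1 - p) + p * of_bool (S = {})"
    proof (cases "S = {}")
      case True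
      have "pr (b ` Y) (\<lambda>T. ?Q (S \<union> T)) \<le> pr (b ` Y) (\<lambda>_. True)" by (rule pr_mono) simp
      then show ?thesis using True pr_True[OF fin(2)] by simp
    next
      case False
      then obtain y where y: "y \<in> Y" "a y \<in> S" using S by blast
      have "pr (b ` Y) (\<lambda>T. ?Q (S \<union> T)) \<le> pr (b ` Y) (\<lambda>T. T \<inter> {b y} = {})"
        using y by (intro pr_mono) auto
      also have "\<dots> = (1 - p) ^ card {b y}" using y by (intro pr_avoid fin) auto
      finally show ?thesis using False by simp
    qed
  qed
  also have "\<dots> = (1 - p) * (\<Sum>S\<in>Pow (a ` Y). wt (a ` Y) S) + p * pr (a ` Y) (\<lambda>S. S = {})"
    unfolding pr_def sum_distrib_left sum.distrib[symmetric] by (simp add: algebra_simps)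
  also have "\<dots> = (1 - p) + p * (1 - p) ^ card Y"
  proof -
    have "pr (a ` Y) (\<lambda>S. S = {}) = pr (a ` Y) (\<lambda>S. S \<inter> a ` Y = {})" by (rule pr_cong) auto
    also have "\<dots> = (1 - p) ^ card (a ` Y)" by (rule pr_avoid[OF fin(1) subset_refl])
    finally show ?thesis using sum_wt[OF fin(1)] card_image[OF assms(2)] by simp
  qed
  finally show ?thesis by (simp add: algebra_simps)
qed

lemma pr_cut:
  assumes "finite V" "T \<subseteq> V" "T' \<subseteq> V" "T \<inter> T' = {}"
  shows "pr (pairs V) (\<lambda>S. \<not> (\<exists>x\<in>T. \<exists>y\<in>T'. adj S x y)) = (1 - p) ^ (card T * card T')"
proof -
  let ?F = "(\<lambda>(x, y). {x, y}) ` (T \<times> T')"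
  have "pr (pairs V) (\<lambda>S. \<not> (\<exists>x\<in>T. \<exists>y\<in>T'. adj S x y)) = pr (pairs V) (\<lambda>S. S \<inter> ?F = {})"
    by (rule pr_cong) (auto simp: adj_def)
  also have "\<dots> = (1 - p) ^ card ?F"
  proof (rule pr_avoid[OF finite_pairs[OF assms(1)]])
    show "?F \<subseteq> pairs V" using assms by (auto simp: pair_in_pairs)
  qed
  also have "card ?F = card (T \<times> T')"
    using assms(4) by (intro card_image) (auto simp: inj_on_def doubleton_eq_iff)
  finally show ?thesis by (simp add: card_cartesian_product)
qed

text \<open>First-moment bound over the sets \<open>U\<close> and the families of
  \<open>m * u + 1\<close> pairs inside them, crudely at most \<open>2 ^ (2 ^ u)\<close> many. The
  one edge beyond \<open>m * u\<close> leaves the isolated factor \<open>p\<close>, and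
  \<open>1 \<le> card V * p ^ m\<close> allows \<open>u\<close> to be replaced by
  \<open>R\<close>.\<close>

lemma pr_dense:
  assumes "finite V" "1 \<le> card V * p ^ m"
  shows "pr (pairs V) (\<lambda>S. \<exists>u\<in>{..R}. \<exists>U\<in>{U. U \<subseteq> V \<and> card U = u}. m * card U < num_edges U (adj S))
    \<le> (R + 1) * (2 ^ (2 ^ R) * p * (card V * p ^ m) ^ R)"
proof (rule pr_Bex_le, goal_cases)
  case (2 u)
  have "pr (pairs V) (\<lambda>S. \<exists>U\<in>{U. U \<subseteq> V \<and> card U = u}. m * card U < num_edges U (adj S))
      \<le> card V ^ u * (2 ^ (2 ^ R) * p ^ (m * u + 1))"
  proof (rule pr_Bex_le, goal_cases)
    case U: (2 U)
    define K where "K = {F. F \<subseteq> Pow U \<and> F \<subseteq> pairs V \<and> card F = m * u + 1}"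
    have finU: "finite U" using U assms(1) finite_subset by blast
    have finK: "finite K" by (rule finite_subset[of _ "Pow (Pow U)"]) (use finU K_def in auto)
    have "card K \<le> card (Pow (Pow U))" using finU by (intro card_mono) (auto simp: K_def)
    also have "\<dots> = 2 ^ (2 ^ u)" using U finU by (simp add: card_Pow)
    also have "\<dots> \<le> 2 ^ (2 ^ R)" using 2 by (intro power_increasing) auto
    finally have cK: "real (card K) \<le> 2 ^ (2 ^ R)"
      by (metis of_nat_le_iff of_nat_numeral of_nat_power)
    have "pr (pairs V) (\<lambda>S. m * card U < num_edges U (adj S)) \<le> pr (pairs V) (\<lambda>S. \<exists>F\<in>K. F \<subseteq> S)"
    proof (rule pr_mono)
      fix S assume S: "S \<subseteq> pairs V" "m * card U < num_edges U (adj S)"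
      let ?X = "{{x, y} |x y. x \<in> U \<and> y \<in> U \<and> adj S x y}"
      have "m * u + 1 \<le> card ?X" using S(2) U unfolding num_edges_def by simp
      then obtain F where F: "F \<subseteq> ?X" "card F = m * u + 1" by (meson obtain_subset_with_card_n)
      have "?X \<subseteq> S" "?X \<subseteq> Pow U" unfolding adj_def by auto
      then have "F \<subseteq> S" "F \<subseteq> Pow U" using F(1) by (meson order_trans)+
      moreover from this have "F \<in> K" using F(2) S(1) unfolding K_def by simp
      ultimately show "\<exists>F\<in>K. F \<subseteq> S" by blast
    qed
    also have "\<dots> \<le> 2 ^ (2 ^ R) * p ^ (m * u + 1)"
    proof (rule pr_Bex_le[OF finK _ cK])
      show "pr (pairs V) (\<lambda>S. F \<subseteq> S) \<le> p ^ (m * u + 1)" if "F \<in> K" for F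
        using that pr_superset[OF finite_pairs[OF assms(1)], of F] unfolding K_def by simp
    qed (use p0 in simp)
    finally show ?case .
  next
    case 3
    show ?case using card_subsets_le[OF assms(1), of u] of_nat_mono by fastforce
  qed (use finite_small_subsets[OF assms(1)] p0 in auto)
  also have "\<dots> = 2 ^ (2 ^ R) * p * (card V * p ^ m) ^ u"
    by (simp add: power_mult_distrib power_mult)
  also have "\<dots> \<le> 2 ^ (2 ^ R) * p * (card V * p ^ m) ^ R"
    using 2 assms(2) p0 by (intro mult_left_mono power_increasing) auto
  finally show ?case .
qed (use p0 in auto)

end

section \<open>Triangles in common neighbourhoods\<close>

definition nbhd :: "'a set set \<Rightarrow> 'a set \<Rightarrow> 'a set \<Rightarrow> 'a set \<Rightarrow> 'a set" where
  "nbhd S J X B = {w \<in> J - (X \<union> B). pattern (adj S) X B w}"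

context bernoulli_subset
begin

text \<open>The edges between \<open>V1\<close> and \<open>V2 \<union> V3\<close> are exposed last: by then every \<open>y\<close> in the
  neighbourhood inside \<open>V2\<close> has a fixed partner \<open>z\<close> inside \<open>V3\<close>, and distinct candidates \<open>w\<close> inside
  \<open>V1\<close> complete such an edge to a triangle independently of each other.\<close>

lemma pr_no_triangle:
  assumes "finite V" and sub: "V1 \<subseteq> V" "V2 \<subseteq> V" "V3 \<subseteq> V"
    and disj: "V1 \<inter> V2 = {}" "V1 \<inter> V3 = {}" "V2 \<inter> V3 = {}"
  shows "pr (pairs V) (\<lambda>S. (\<nu> \<le> card (nbhd S V1 X B) \<and> \<mu> \<le> card (nbhd S V2 X B)
      \<and> (\<forall>y\<in>nbhd S V2 X B. \<exists>z\<in>nbhd S V3 X B. adj S y z))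
      \<and> \<not> (\<exists>w\<in>nbhd S V1 X B. \<exists>y\<in>nbhd S V2 X B. \<exists>z\<in>nbhd S V3 X B. adj S w y \<and> adj S w z \<and> adj S y z))
    \<le> (1 - p * (1 - (1 - p) ^ \<mu>)) ^ \<nu>"
proof -
  \<comment> \<open>Removing \<open>X \<union> B\<close> from both sides keeps every pair that meets
    \<open>X \<union> B\<close> in \<open>I\<close>, so the three neighbourhoods are already
    determined when \<open>J\<close> is exposed.\<close>
  define U1 where "U1 = V1 - (X \<union> B)"
  define U23 where "U23 = (V2 \<union> V3) - (X \<union> B)"
  define J where "J = {{w, x} |w x. w \<in> U1 \<and> x \<in> U23}"
  define I where "I = pairs V - J"
  define Q1 where "Q1 S \<longleftrightarrow> \<nu> \<le> card (nbhd S V1 X B) \<and> \<mu> \<le> card (nbhd S V2 X B)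
      \<and> (\<forall>y\<in>nbhd S V2 X B. \<exists>z\<in>nbhd S V3 X B. adj S y z)" for S
  define Q where "Q S \<longleftrightarrow> \<not> (\<exists>w\<in>nbhd S V1 X B. \<exists>y\<in>nbhd S V2 X B. \<exists>z\<in>nbhd S V3 X B.
      adj S w y \<and> adj S w z \<and> adj S y z)" for S
  define \<epsilon> where "\<epsilon> = 1 - p * (1 - (1 - p) ^ \<mu>)"
  have pow: "0 \<le> (1 - p) ^ \<mu>" "(1 - p) ^ \<mu> \<le> 1" using p0 p1 by (simp_all add: power_le_one)
  have "p * (1 - (1 - p) ^ \<mu>) \<le> 1 * 1" using pow p0 p1 by (intro mult_mono) auto
  moreover have "0 \<le> p * (1 - (1 - p) ^ \<mu>)" using pow p0 by simp
  ultimately have \<epsilon>: "0 \<le> \<epsilon>" "\<epsilon> \<le> 1" unfolding \<epsilon>_def by auto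
  have JV: "J \<subseteq> pairs V"
  proof
    fix e assume "e \<in> J"
    then obtain w x where "e = {w, x}" "w \<in> U1" "x \<in> U23" unfolding J_def by blast
    then show "e \<in> pairs V" unfolding U1_def U23_def using sub disj by (auto simp: pair_in_pairs)
  qed
  have fin: "finite I" "finite J" "I \<inter> J = {}" "I \<union> J = pairs V"
    using finite_pairs[OF assms(1)] JV finite_subset unfolding I_def by auto
  have old_X: "{x, w} \<notin> J" if "x \<in> X \<union> B" for x w
  proof
    assume "{x, w} \<in> J"
    then obtain a b where "{x, w} = {a, b}" "a \<in> U1" "b \<in> U23" unfolding J_def by blast
    then show False using that unfolding U1_def U23_def by (auto simp: doubleton_eq_iff)
  qed
  have old_23: "{y, z} \<notin> J" if "y \<in> V2" "z \<in> V3" for y z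
  proof
    assume "{y, z} \<in> J"
    then obtain a b where "{y, z} = {a, b}" "a \<in> U1" "b \<in> U23" unfolding J_def by blast
    then show False using that disj unfolding U1_def U23_def by (auto simp: doubleton_eq_iff)
  qed
  have nbhd_Un: "nbhd (S \<union> T) K X B = nbhd S K X B" if "T \<subseteq> J" for S T K
  proof -
    have "pattern (adj (S \<union> T)) X B w = pattern (adj S) X B w" for w
    proof -
      have "adj (S \<union> T) x w = adj S x w" if "x \<in> X \<union> B" for x
        using old_X[OF that, of w] \<open>T \<subseteq> J\<close> unfolding adj_def by blast
      then show ?thesis unfolding pattern_def by simp
    qed
    then show ?thesis unfolding nbhd_def by simp
  qed
  have adj_Un: "adj (S \<union> T) y z = adj S y z" if "T \<subseteq> J" "y \<in> nbhd S' V2 X B" "z \<in> nbhd S'' V3 X B" for S S' S'' T y z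
    using that old_23[of y z] unfolding adj_def nbhd_def by blast
  have Q1_Un: "Q1 (S \<union> T) = Q1 S" if "T \<subseteq> J" for S T
    unfolding Q1_def nbhd_Un[OF that] using adj_Un[OF that] by (metis (no_types, lifting))
  have bound: "pr J (\<lambda>T. Q (S \<union> T)) \<le> \<epsilon> ^ \<nu>" if S: "S \<subseteq> I" "Q1 S" for S
  proof -
    define W where "W = nbhd S V1 X B"
    define Y where "Y = nbhd S V2 X B"
    define Z where "Z = nbhd S V3 X B"
    have "\<forall>y\<in>Y. \<exists>z. z \<in> Z \<and> adj S y z" using S(2) unfolding Q1_def Y_def Z_def by blast
    then obtain f where f: "\<And>y. y \<in> Y \<Longrightarrow> f y \<in> Z \<and> adj S y (f y)" by metis
    have U: "W \<subseteq> U1" "Y \<subseteq> U23" "Z \<subseteq> U23" "W \<subseteq> V1" "Y \<subseteq> V2" "Z \<subseteq> V3"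
      unfolding W_def Y_def Z_def U1_def U23_def nbhd_def by auto
    have "W \<subseteq> V" "Y \<subseteq> V" using U(4,5) sub(1,2) by auto
    then have finWY: "finite W" "finite Y" using assms(1) by (auto intro: finite_subset)
    have card: "\<nu> \<le> card W" "\<mu> \<le> card Y" using S(2) unfolding Q1_def W_def Y_def by auto
    define D where "D w = (\<lambda>y. {w, y}) ` Y \<union> (\<lambda>y. {w, f y}) ` Y" for w
    have DE: "\<exists>x\<in>U23. e = {w, x}" if "e \<in> D w" for e w
    proof -
      from that obtain y where y: "y \<in> Y" "e = {w, y} \<or> e = {w, f y}" unfolding D_def by blast
      then have "y \<in> U23" "f y \<in> U23" using f[OF y(1)] U(2,3) by auto
      then show ?thesis using y(2) by blast
    qed
    define P where "P w T \<longleftrightarrow> \<not> (\<exists>y\<in>Y. {w, y} \<in> T \<and> {w, f y} \<in> T)" for w T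
    have "pr J (\<lambda>T. Q (S \<union> T)) \<le> pr J (\<lambda>T. \<forall>w\<in>W. P w (T \<inter> D w))"
    proof (rule pr_mono, rule ballI)
      fix T w assume T: "T \<subseteq> J" "Q (S \<union> T)" "w \<in> W"
      show "P w (T \<inter> D w)"
        unfolding P_def
      proof
        assume "\<exists>y\<in>Y. {w, y} \<in> T \<inter> D w \<and> {w, f y} \<in> T \<inter> D w"
        then obtain y where y: "y \<in> Y" "{w, y} \<in> T" "{w, f y} \<in> T" by blast
        then have "adj (S \<union> T) w y" "adj (S \<union> T) w (f y)" "adj (S \<union> T) y (f y)"
          using f[OF y(1)] unfolding adj_def by auto
        then show False
          using T(2,3) y(1) f[OF y(1)] unfolding Q_def nbhd_Un[OF T(1)] W_def Y_def Z_def by blast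
      qed
    qed
    also have "\<dots> \<le> \<epsilon> ^ card W"
    proof (rule pr_Ball_le[OF finWY(1) fin(2) \<epsilon>(1)])
      fix w assume w: "w \<in> W"
      show "D w \<subseteq> J"
      proof
        fix e assume "e \<in> D w"
        then obtain x where "e = {w, x}" "x \<in> U23" using DE by blast
        then show "e \<in> J" using w U unfolding J_def by blast
      qed
      have "pr (D w) (P w) \<le> 1 - p * (1 - (1 - p) ^ card Y)"
        unfolding D_def P_def
      proof (rule pr_no_cherry[OF finWY(2)])
        show "inj_on (\<lambda>y. {w, y}) Y" by (auto simp: inj_on_def doubleton_eq_iff)
        show "(\<lambda>y. {w, y}) ` Y \<inter> (\<lambda>y. {w, f y}) ` Y = {}"
        proof (rule ccontr)
          assume "\<not> ?thesis"
          then obtain y y' where yy: "y \<in> Y" "y' \<in> Y" "{w, y} = {w, f y'}" by blast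
          then have "y = f y'" by (auto simp: doubleton_eq_iff)
          then show False using yy U(5,6) f[OF yy(2)] disj(3) by blast
        qed
      qed
      also have "\<dots> \<le> \<epsilon>"
        unfolding \<epsilon>_def using power_decreasing[OF card(2), of "1 - p"] p0 p1 by (simp add: mult_left_mono)
      finally show "pr (D w) (P w) \<le> \<epsilon>" .
    next
      fix w w' assume w: "w \<in> W" "w' \<in> W" "w \<noteq> w'"
      have no: "u \<notin> U23" if "u \<in> W" for u
        using that U(4) disj unfolding U23_def by blast
      show "D w \<inter> D w' = {}"
      proof (rule ccontr)
        assume "D w \<inter> D w' \<noteq> {}"
        then obtain e where "e \<in> D w" "e \<in> D w'" by blast
        then obtain x x' where "x \<in> U23" "x' \<in> U23" "{w, x} = {w', x'}"
          using DE by metis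
        then show False using w no by (auto simp: doubleton_eq_iff)
      qed
    qed
    also have "\<dots> \<le> \<epsilon> ^ \<nu>" by (rule power_decreasing[OF card(1) \<epsilon>])
    finally show ?thesis .
  qed
  have "pr (I \<union> J) (\<lambda>S. Q1 (S \<inter> I) \<and> Q S) \<le> \<epsilon> ^ \<nu>"
    using fin \<epsilon> bound by (intro pr_conditional) auto
  moreover have "pr (pairs V) (\<lambda>S. Q1 S \<and> Q S) = pr (I \<union> J) (\<lambda>S. Q1 (S \<inter> I) \<and> Q S)"
    unfolding fin(4)
  proof (rule pr_cong)
    fix S assume "S \<subseteq> pairs V"
    then have "S = S \<inter> I \<union> S \<inter> J" using fin(4) by blast
    then show "(Q1 S \<and> Q S) = (Q1 (S \<inter> I) \<and> Q S)" using Q1_Un[of "S \<inter> J" "S \<inter> I"] by simp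
  qed
  ultimately show ?thesis unfolding Q1_def Q_def \<epsilon>_def by simp
qed

end

section \<open>Connectivity, counting and asymptotics\<close>

lemma k_connectedI:
  assumes "finite V" "k < card V" and sym: "\<And>x y. E x y \<Longrightarrow> E y x"
    and cut: "\<And>X T. \<lbrakk>X \<subseteq> V; card X \<le> k; T \<subseteq> V - X; T \<noteq> {}; 2 * card T \<le> card (V - X)\<rbrakk>
      \<Longrightarrow> \<exists>x\<in>T. \<exists>y\<in>V - X - T. E x y"
  shows "k_connected V E k"
proof -
  have conn: "connected_graph (V - X) E" if X: "X \<subseteq> V" "card X \<le> k" for X
    unfolding connected_graph_def
  proof (intro conjI ballI)
    have "card X < card V" using X assms(2) by simp
    then show "V - X \<noteq> {}" using X by auto
    fix u v assume u: "u \<in> V - X" and v: "v \<in> V - X"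
    let ?r = "\<lambda>x y. x \<in> V - X \<and> y \<in> V - X \<and> E x y"
    define K where "K = {w \<in> V - X. ?r\<^sup>*\<^sup>* u w}"
    have closed: "y \<in> K" if "x \<in> K" "y \<in> V - X" "E x y" for x y
    proof -
      have "?r\<^sup>*\<^sup>* u x" "?r x y" using that unfolding K_def by auto
      then have "?r\<^sup>*\<^sup>* u y" by (rule rtranclp.rtrancl_into_rtrancl)
      then show ?thesis using that unfolding K_def by simp
    qed
    have K: "K \<subseteq> V - X" "u \<in> K" using u unfolding K_def by auto
    have finX: "finite (V - X)" using assms(1) by simp
    have "v \<in> K"
    proof (rule ccontr)
      assume vK: "v \<notin> K"
      have "card (V - X - K) = card (V - X) - card K"
        using K finX by (intro card_Diff_subset) (auto intro: finite_subset)
      \<comment> \<open>Whichever of the component and its complement is the smaller serves as the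
        cut. Restricting cuts to at most half of the vertices keeps the opposite side large in the
        probability estimate.\<close>
      then consider "2 * card K \<le> card (V - X)" | "2 * card (V - X - K) \<le> card (V - X)" by linarith
      then show False
      proof cases
        case 1
        then show False using cut[OF X K(1) _ 1] K(2) closed by blast
      next
        case 2
        have "V - X - (V - X - K) = K" using K by blast
        then obtain x y where "x \<in> V - X - K" "y \<in> K" "E x y"
          using cut[OF X _ _ 2] v vK by auto
        then show False using closed[of y x] sym by blast
      qed
    qed
    then show "?r\<^sup>*\<^sup>* u v" unfolding K_def by simp
  qed
  from conn[of "{}"] have "connected_graph V E" by simp
  then show ?thesis unfolding k_connected_def using assms(2) conn by simp
qed

lemma kappa_ge:
  assumes "k_connected V E k"
  shows "k \<le> kappa V E"
  unfolding kappa_def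
  by (rule Greatest_le_nat[of _ _ "card V"]) (use assms in \<open>auto simp: k_connected_def\<close>)

text \<open>Takes the place of a concentration inequality: a large common neighbourhood is obtained
  from the existence of one member in each of \<open>r\<close> disjoint intervals.\<close>

lemma card_ge_blocks:
  fixes K :: "nat set"
  assumes "finite K" and "\<And>l. l < r \<Longrightarrow> \<exists>y\<in>{c + l * b..<c + (l + 1) * b}. y \<in> K"
  shows "r \<le> card K"
proof -
  obtain g where g: "\<And>l. l < r \<Longrightarrow> c + l * b \<le> g l \<and> g l < c + (l + 1) * b \<and> g l \<in> K"
    using assms(2) by (metis atLeastLessThan_iff)
  have less: "g l < g l'" if "l < l'" "l' < r" for l l'
  proof -
    have "(l + 1) * b \<le> l' * b" using that by (intro mult_le_mono1) simp
    then show ?thesis using g[of l] g[of l'] that by linarith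
  qed
  have "inj_on g {..<r}"
  proof (rule inj_onI)
    fix l l' assume "l \<in> {..<r}" "l' \<in> {..<r}" "g l = g l'"
    then show "l = l'" using less[of l l'] less[of l' l] by (cases l l' rule: linorder_cases) auto
  qed
  then have "r = card (g ` {..<r})" by (simp add: card_image)
  also have "\<dots> \<le> card K" using g assms(1) by (intro card_mono) auto
  finally show ?thesis .
qed

text \<open>The random graph will have \<open>3 * t ^ c\<close> vertices, so the union bounds other
  than the one for sparseness compare a polynomial in \<open>t\<close> with an exponential.\<close>

lemma eventually_poly_exp_less:
  fixes C :: real
  assumes "0 < \<delta>"
  shows "\<forall>\<^sub>F t :: nat in sequentially. C * (3 * real t ^ c) ^ M * exp (- (real t / 4)) < \<delta>"
proof -
  have "filterlim (\<lambda>t :: nat. real t / 4) at_top sequentially"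
    by (rule filterlim_at_top_mult_tendsto_pos[where f = "\<lambda>_. 1 / 4" and c = "1 / 4", simplified])
      (auto intro: filterlim_real_sequentially)
  from filterlim_compose[OF tendsto_power_div_exp_0[of "c * M"] this]
  have "(\<lambda>t :: nat. C * 3 ^ M * 4 ^ (c * M) * ((real t / 4) ^ (c * M) / exp (real t / 4))) \<longlonglongrightarrow> C * 3 ^ M * 4 ^ (c * M) * 0"
    by (intro tendsto_intros)
  moreover have "C * 3 ^ M * 4 ^ (c * M) * ((real t / 4) ^ (c * M) / exp (real t / 4))
      = C * (3 * real t ^ c) ^ M * exp (- (real t / 4))" for t :: nat
    by (simp add: power_divide power_mult_distrib exp_minus field_simps flip: power_mult)
  ultimately have "(\<lambda>t :: nat. C * (3 * real t ^ c) ^ M * exp (- (real t / 4))) \<longlonglongrightarrow> 0" by simp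
  then show ?thesis using assms by (rule order_tendstoD(2))
qed

section \<open>Union bounds for cuts and triangles\<close>

context bernoulli_subset
begin

text \<open>Removing \<open>X\<close> leaves at least \<open>2 * N\<close> vertices and
  \<open>T\<close> takes at most half of what is left, so at least \<open>N\<close> lie opposite.
  All \<open>T\<close> of size \<open>j\<close> together contribute at most
  \<open>(card V * exp (- (p * N))) ^ j\<close>, and the last hypothesis reduces this to
  \<open>j = 1\<close>.\<close>

lemma pr_cuts:
  assumes "finite V" "V \<noteq> {}" "card V = 3 * N" "3 * k \<le> card V" "card V * exp (- (p * N)) \<le> 1"
  shows "pr (pairs V) (\<lambda>S. \<exists>X\<in>{X. X \<subseteq> V \<and> card X \<le> k}. \<exists>j\<in>{1..card V}. \<exists>T\<in>{T. T \<subseteq> V \<and> card T = j}.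
      T \<inter> X = {} \<and> 2 * card T \<le> card (V - X) \<and> \<not> (\<exists>x\<in>T. \<exists>y\<in>V - X - T. adj S x y))
    \<le> ((k + 1) * card V ^ k) * (card V * (card V * exp (- (p * N))))"
proof (rule pr_Bex_le, goal_cases)
  case X: (2 X)
  show ?case
  proof (rule pr_Bex_le, goal_cases)
    case j: (2 j)
    let ?\<delta> = "exp (- (p * N))"
    have "pr (pairs V) (\<lambda>S. \<exists>T\<in>{T. T \<subseteq> V \<and> card T = j}.
      T \<inter> X = {} \<and> 2 * card T \<le> card (V - X) \<and> \<not> (\<exists>x\<in>T. \<exists>y\<in>V - X - T. adj S x y)) \<le> real (card V ^ j) * ?\<delta> ^ j"
    proof (rule pr_Bex_le, goal_cases)
      case T: (2 T)
      show ?case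
      proof (cases "T \<inter> X = {} \<and> 2 * card T \<le> card (V - X)")
        case True
        have finX: "finite X" "finite T" using X T assms(1) finite_subset by blast+
        have "card (V - X) = card V - card X" using X finX by (intro card_Diff_subset) auto
        moreover have "card (V - X - T) = card (V - X) - card T"
          using True T finX by (intro card_Diff_subset) auto
        moreover have "2 * card T \<le> card (V - X)" "card X \<le> k" using True X by auto
        ultimately have "N \<le> card (V - X - T)" using assms(3,4) by arith
        then have N: "j * N \<le> card T * card (V - X - T)" using T by simp
        have "pr (pairs V) (\<lambda>S. T \<inter> X = {} \<and> 2 * card T \<le> card (V - X) \<and> \<not> (\<exists>x\<in>T. \<exists>y\<in>V - X - T. adj S x y))
            = pr (pairs V) (\<lambda>S. \<not> (\<exists>x\<in>T. \<exists>y\<in>V - X - T. adj S x y))" using True by simp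
        also have "\<dots> = (1 - p) ^ (card T * card (V - X - T))"
          using T by (intro pr_cut assms(1)) auto
        also have "\<dots> \<le> (1 - p) ^ (j * N)" using N p0 p1 by (intro power_decreasing) auto
        also have "\<dots> \<le> exp (- p) ^ (j * N)"
          using p1 exp_ge_add_one_self[of "- p"] by (intro power_mono) auto
        also have "\<dots> = ?\<delta> ^ j"
          by (simp add: exp_of_nat_mult[symmetric] mult_ac)
        finally show ?thesis .
      next
        case False
        have "pr (pairs V) (\<lambda>S. T \<inter> X = {} \<and> 2 * card T \<le> card (V - X)
            \<and> \<not> (\<exists>x\<in>T. \<exists>y\<in>V - X - T. adj S x y)) = pr (pairs V) (\<lambda>_. False)"
          using False by (intro pr_cong) auto
        also have "\<dots> = 0" unfolding pr_def by simp
        finally show ?thesis by simp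
      qed
    next
      case 3
      show ?case using card_subsets_le[OF assms(1), of j] of_nat_mono by blast
    qed (use finite_small_subsets[OF assms(1)] in auto)
    also have "\<dots> = (card V * ?\<delta>) ^ j" by (simp add: power_mult_distrib)
    also have "\<dots> \<le> (card V * ?\<delta>) ^ 1" using j assms(5) by (intro power_decreasing) auto
    finally show ?case by simp
  qed (use assms in auto)
next
  case 3
  show ?case using card_small_subsets_le[OF assms(1,2), of k] of_nat_mono by fastforce
qed (use finite_small_subsets[OF assms(1)] in auto)

text \<open>From \<open>1 \<le> p * \<mu>\<close> follows
  \<open>(1 - p) ^ \<mu> \<le> exp (- 1) \<le> 1 / 2\<close>. The failure bound of
  \<open>pr_no_triangle\<close> per candidate \<open>w\<close> is then at most
  \<open>1 - p / 2\<close>, whence the exponent \<open>p * \<nu> / 2\<close>.\<close>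

lemma pr_no_triangles_exp:
  assumes "finite V" "V \<noteq> {}" and sub: "V1 \<subseteq> V" "V2 \<subseteq> V" "V3 \<subseteq> V"
    and disj: "V1 \<inter> V2 = {}" "V1 \<inter> V3 = {}" "V2 \<inter> V3 = {}"
    and \<mu>: "1 \<le> p * \<mu>"
  shows "pr (pairs V) (\<lambda>S. \<exists>X\<in>{X. X \<subseteq> V \<and> card X \<le> m}. \<exists>B\<in>{B. B \<subseteq> V \<and> card B \<le> s}.
      (\<nu> \<le> card (nbhd S V1 X B) \<and> \<mu> \<le> card (nbhd S V2 X B)
      \<and> (\<forall>y\<in>nbhd S V2 X B. \<exists>z\<in>nbhd S V3 X B. adj S y z))
      \<and> \<not> (\<exists>w\<in>nbhd S V1 X B. \<exists>y\<in>nbhd S V2 X B. \<exists>z\<in>nbhd S V3 X B. adj S w y \<and> adj S w z \<and> adj S y z))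
    \<le> ((m + 1) * card V ^ m) * (((s + 1) * card V ^ s) * exp (- (p * \<nu> / 2)))"
proof (rule pr_Bex_le, goal_cases)
  case (2 X)
  show ?case
  proof (rule pr_Bex_le, goal_cases)
    case (2 B)
    have "(1 - p) ^ \<mu> \<le> exp (- p) ^ \<mu>"
      using p1 exp_ge_add_one_self[of "- p"] by (intro power_mono) auto
    also have "\<dots> = exp (- (p * \<mu>))" by (simp add: exp_of_nat_mult[symmetric] mult_ac)
    also have "\<dots> \<le> exp (- 1)" using \<mu> by simp
    also have "\<dots> \<le> 1 / 2"
      using exp_ge_add_one_self[of 1] by (simp add: exp_minus field_simps)
    finally have half: "(1 - p) ^ \<mu> \<le> 1 / 2" .
    then have "p * (1 / 2) \<le> p * (1 - (1 - p) ^ \<mu>)" using p0 by (intro mult_left_mono) auto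
    then have le: "1 - p * (1 - (1 - p) ^ \<mu>) \<le> exp (- (p / 2))"
      using exp_ge_add_one_self[of "- (p / 2)"] by simp
    have "p * (1 - (1 - p) ^ \<mu>) \<le> 1 * 1"
      using p0 p1 half by (intro mult_mono) auto
    then have "(1 - p * (1 - (1 - p) ^ \<mu>)) ^ \<nu> \<le> exp (- (p / 2)) ^ \<nu>"
      using le by (intro power_mono) auto
    also have "\<dots> = exp (- (p * \<nu> / 2))" by (simp add: exp_of_nat_mult[symmetric] mult_ac)
    finally show ?case
      using pr_no_triangle[OF assms(1) sub disj, of \<nu> X B \<mu>] by linarith
  next
    case 3
    show ?case using card_small_subsets_le[OF assms(1,2), of s] of_nat_mono by fastforce
  qed (use finite_small_subsets[OF assms(1)] in auto)
next
  case 3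
  show ?case using card_small_subsets_le[OF assms(1,2), of m] of_nat_mono by fastforce
qed (use finite_small_subsets[OF assms(1)] in auto)

end

lemma graph_adj:
  assumes "finite V" "S \<subseteq> pairs V"
  shows "graph V (adj S)"
proof -
  have S: "x \<in> V \<and> y \<in> V \<and> x \<noteq> y" if "{x, y} \<in> S" for x y
    using that assms(2) pair_in_pairs[of x y V] by blast
  show ?thesis
    unfolding graph_def adj_def using assms(1) S S[of x x for x]
    by (auto simp: insert_commute)
qed

lemma robust_graph_exists:
  fixes m s R k v :: nat
  assumes "1 \<le> m" "R \<le> s"
  shows "\<exists>n E. robust {..<n} E m s R \<and> k_connected {..<n} E k \<and> v \<le> n"
proof -
  \<comment> \<open>\<open>c\<close> is chosen so that \<open>N = t ^ c\<close>. \<open>M\<close>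
    exceeds every power of the number of vertices in the exponential union bounds (cuts need
    \<open>k + 2\<close>), and \<open>C\<close> dominates their constant factors.\<close>
  define c where "c = 2 + (2 * R + 1) * m"
  define M where "M = m + s + k + 2"
  define C :: real where "C = real ((m + 1) * (s + 1) * (k + 1))"
  have "(\<lambda>t :: nat. (real R + 1) * 2 ^ (2 ^ R) * 3 ^ R * (1 / real t)) \<longlonglongrightarrow> (real R + 1) * 2 ^ (2 ^ R) * 3 ^ R * 0"
    by (intro tendsto_intros lim_1_over_n)
  then have "\<forall>\<^sub>F t :: nat in sequentially. (real R + 1) * 2 ^ (2 ^ R) * 3 ^ R * (1 / real t) < 1 / 8"
    by (intro order_tendstoD(2)[where y = 0]) auto
  moreover have "\<forall>\<^sub>F t :: nat in sequentially. C * (3 * real t ^ c) ^ M * exp (- (real t / 4)) < 1 / 8"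
    by (rule eventually_poly_exp_less) simp
  moreover have "\<forall>\<^sub>F t :: nat in sequentially. 2 * (m + s) + 3 * k + v + 1 \<le> t"
    by (rule eventually_ge_at_top)
  ultimately have "\<forall>\<^sub>F t :: nat in sequentially. (real R + 1) * 2 ^ (2 ^ R) * 3 ^ R * (1 / real t) < 1 / 8
      \<and> C * (3 * real t ^ c) ^ M * exp (- (real t / 4)) < 1 / 8 \<and> 2 * (m + s) + 3 * k + v + 1 \<le> t"
    by (intro eventually_conj)
  then obtain t :: nat where t: "(real R + 1) * 2 ^ (2 ^ R) * 3 ^ R * (1 / real t) < 1 / 8"
      "C * (3 * real t ^ c) ^ M * exp (- (real t / 4)) < 1 / 8" "2 * (m + s) + 3 * k + v + 1 \<le> t"
    using eventually_happens'[OF sequentially_bot] by blast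
  \<comment> \<open>With \<open>n = 3 * N\<close> vertices and edge probability \<open>p = 1 / q\<close> we have \<open>n * p ^ m = 3 * t\<^sup>2\<close>, large compared
    with \<open>ln n\<close>, while \<open>p * (n * p ^ m) ^ R\<close> tends to 0: every \<open>m\<close> vertices have common neighbours,
    but no \<open>u \<le> R\<close> vertices span more than \<open>m * u\<close> edges.\<close>
  define q where "q = t ^ (2 * R + 1)"
  define N where "N = t ^ 2 * q ^ m"
  \<comment> \<open>Block size: \<open>p ^ (m - 1) * b = t\<close>, so that any \<open>m - 1\<close>
    vertices should have a common neighbour in each block. A part of \<open>N\<close> vertices
    consists of \<open>t * q\<close> blocks.\<close>
  define b where "b = t * q ^ (m - 1)"
  define V where "V = {..<3 * N}"
  define p where "p = 1 / real q"
  have t1: "1 \<le> t" using t(3) by simp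
  have tq: "t \<le> q" unfolding q_def using t1 power_increasing[of 1 "2 * R + 1" t] by simp
  have q1: "1 \<le> q" using t1 tq by simp
  have qm: "q ^ m = q * q ^ (m - 1)" using assms(1) by (metis power_eq_if not_one_le_zero)
  have Nb: "N = (t * q) * b" unfolding N_def b_def qm by (simp add: power2_eq_square)
  have tb: "t \<le> b" unfolding b_def using q1 by simp
  have tN: "t \<le> N" unfolding Nb using tb t1 q1 by (simp add: Suc_le_eq)
  have tqN: "2 * (t * q) \<le> 3 * N" unfolding Nb using tb t1 by simp
  have n3: "3 * N = 3 * t ^ c" unfolding N_def q_def c_def by (simp only: power_add power_mult)
  have N1: "1 \<le> 3 * N" using tN t1 by simp
  have finV: "finite V" "V \<noteq> {}" "card V = 3 * N" unfolding V_def using N1 by (auto simp: lessThan_empty_iff bot_nat_def)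
  have pq: "p * real q = 1" and pm: "p ^ m * real (q ^ m) = 1" and pm1: "p ^ (m - 1) * real (q ^ (m - 1)) = 1"
    unfolding p_def using q1 by (simp_all add: power_one_over)
  interpret bernoulli_subset p
    by standard (use q1 in \<open>simp_all add: p_def\<close>)
  define \<epsilon> where "\<epsilon> = exp (- (real t / 4))"
  have small: "x * \<epsilon> < 1 / 8" if "x \<le> C * real (3 * N) ^ M" for x :: real
  proof -
    have "x * \<epsilon> \<le> C * real (3 * N) ^ M * \<epsilon>" using that unfolding \<epsilon>_def by (intro mult_right_mono) auto
    also have "\<dots> = C * (3 * real t ^ c) ^ M * exp (- (real t / 4))" unfolding n3 \<epsilon>_def by simp
    finally show ?thesis using t(2) by linarith
  qed
  have poly: "real (a * (3 * N) ^ i) \<le> C * real (3 * N) ^ M" if "a \<le> (m + 1) * (s + 1) * (k + 1)" "i \<le> M" for a i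
  proof -
    have "a * (3 * N) ^ i \<le> ((m + 1) * (s + 1) * (k + 1)) * (3 * N) ^ M"
      using that(1) power_increasing[OF that(2) N1] by (rule mult_le_mono)
    then have "real (a * (3 * N) ^ i) \<le> real (((m + 1) * (s + 1) * (k + 1)) * (3 * N) ^ M)"
      by (rule of_nat_mono)
    then show ?thesis unfolding C_def by (simp only: of_nat_mult of_nat_power)
  qed
  \<comment> \<open>The parts host the three corners of a triangle. Many candidates in
    \<open>V1\<close> and in \<open>V2\<close> are found block by block; every candidate in
    \<open>V2\<close> gets its partner in \<open>V3\<close> from the extension property for
    \<open>m\<close> vertices.\<close>
  define V1 where "V1 = {..<N}"
  define V2 where "V2 = {N..<2 * N}"
  define V3 where "V3 = {2 * N..<3 * N}"
  define block where "block i l = {i * N + l * b..<i * N + (l + 1) * b}" for i l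
  define \<J> where "\<J> = (\<lambda>(i, l). block i l) ` ({..<2} \<times> {..<t * q})"
  have block_sub: "block i l \<subseteq> {i * N..<i * N + N}" if "l < t * q" for i l
  proof -
    have "(l + 1) * b \<le> N" unfolding Nb using that by (intro mult_le_mono1) simp
    then show ?thesis unfolding block_def by auto
  qed
  have part_sub: "{i * N..<i * N + N} \<subseteq> V" if "i < 2" for i
  proof -
    have "i = 0 \<or> i = 1" using that by auto
    then show ?thesis by (elim disjE) (auto simp: V_def)
  qed
  have sp: "real s * p \<le> 1 / 2"
  proof -
    have "2 * s \<le> q" using t(3) tq by simp
    then have "real s * 2 \<le> real q" by linarith
    then show ?thesis unfolding p_def using q1 by (simp add: field_simps)
  qed

  \<comment> \<open>Five bad events, each to have probability below \<open>1 / 8\<close>: no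
    extension in \<open>V3\<close>, none in some block, no triangle despite large neighbourhoods, a
    dense small set, a small cut.\<close>
  define bad1 where "bad1 S \<longleftrightarrow> (\<exists>A\<in>{A. A \<subseteq> V \<and> card A \<le> m}. \<exists>B\<in>{B. B \<subseteq> V \<and> card B \<le> s}. \<exists>J\<in>{V3}.
      A \<inter> B = {} \<and> \<not> (\<exists>y\<in>J - (A \<union> B). pattern (adj S) A B y))" for S
  define bad2 where "bad2 S \<longleftrightarrow> (\<exists>A\<in>{A. A \<subseteq> V \<and> card A \<le> m - 1}. \<exists>B\<in>{B. B \<subseteq> V \<and> card B \<le> s}. \<exists>J\<in>\<J>.
      A \<inter> B = {} \<and> \<not> (\<exists>y\<in>J - (A \<union> B). pattern (adj S) A B y))" for S
  define bad3 where "bad3 S \<longleftrightarrow> (\<exists>X\<in>{X. X \<subseteq> V \<and> card X \<le> m}. \<exists>B\<in>{B. B \<subseteq> V \<and> card B \<le> s}.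
      (t * q \<le> card (nbhd S V1 X B) \<and> q \<le> card (nbhd S V2 X B)
      \<and> (\<forall>y\<in>nbhd S V2 X B. \<exists>z\<in>nbhd S V3 X B. adj S y z))
      \<and> \<not> (\<exists>w\<in>nbhd S V1 X B. \<exists>y\<in>nbhd S V2 X B. \<exists>z\<in>nbhd S V3 X B. adj S w y \<and> adj S w z \<and> adj S y z))" for S
  define bad4 where "bad4 S \<longleftrightarrow> (\<exists>u\<in>{..R}. \<exists>U\<in>{U. U \<subseteq> V \<and> card U = u}. m * card U < num_edges U (adj S))" for S
  define bad5 where "bad5 S \<longleftrightarrow> (\<exists>X\<in>{X. X \<subseteq> V \<and> card X \<le> k}. \<exists>j\<in>{1..card V}. \<exists>T\<in>{T. T \<subseteq> V \<and> card T = j}.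
      T \<inter> X = {} \<and> 2 * card T \<le> card (V - X) \<and> \<not> (\<exists>x\<in>T. \<exists>y\<in>V - X - T. adj S x y))" for S

  have "pr (pairs V) bad1 < 1 / 8"
  proof -
    have "real t \<le> p ^ m * real N"
    proof -
      have "p ^ m * real N = real t ^ 2 * (p ^ m * real (q ^ m))" unfolding N_def by simp
      also have "\<dots> = real t ^ 2" unfolding pm by simp
      also have "\<dots> \<ge> real t" using t1 by (simp add: power2_eq_square)
      finally show ?thesis .
    qed
    then have "pr (pairs V) bad1 \<le> ((m + 1) * card V ^ m) * (((s + 1) * card V ^ s) * (card {V3} * exp (- (real t / 4))))"
      unfolding bad1_def using t(3) tN sp finV
      by (intro pr_patterns_exp) (auto simp: V3_def V_def)
    also have "\<dots> = real (((m + 1) * (s + 1)) * (3 * N) ^ (m + s)) * \<epsilon>"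
      unfolding finV \<epsilon>_def by (simp add: power_add algebra_simps)
    also have "\<dots> < 1 / 8" by (intro small poly) (auto simp: M_def)
    finally show ?thesis .
  qed
  moreover have "pr (pairs V) bad2 < 1 / 8"
  proof -
    have "real t \<le> p ^ (m - 1) * real b" using pm1 unfolding b_def by (simp add: algebra_simps)
    then have cond: "J \<subseteq> V \<and> 2 * (m - 1 + s) \<le> card J \<and> 4 * (real t / 4) \<le> p ^ (m - 1) * card J" if JJ: "J \<in> \<J>" for J
    proof -
      obtain i l where J: "J = block i l" "i < 2" "l < t * q" using JJ unfolding \<J>_def by auto
      have "J \<subseteq> V" using block_sub[OF J(3), of i] part_sub[OF J(2)] J(1) by blast
      moreover have "card J = b" unfolding J(1) block_def by simp
      ultimately show ?thesis using \<open>real t \<le> _\<close> tb t(3) by auto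
    qed
    have "finite \<J>" unfolding \<J>_def by simp
    have "card \<J> \<le> card ({..<2 :: nat} \<times> {..<t * q})" unfolding \<J>_def by (rule card_image_le) simp
    also have "\<dots> = 2 * (t * q)" by simp
    finally have cJ: "card \<J> \<le> 3 * N" using tqN by linarith
    have "pr (pairs V) bad2 \<le> ((m - 1 + 1) * card V ^ (m - 1)) * (((s + 1) * card V ^ s) * (card \<J> * exp (- (real t / 4))))"
      unfolding bad2_def by (rule pr_patterns_exp[OF finV(1,2) \<open>finite \<J>\<close> sp cond])
    also have "\<dots> = real ((m * (3 * N) ^ (m - 1)) * ((s + 1) * (3 * N) ^ s) * card \<J>) * \<epsilon>"
      unfolding finV \<epsilon>_def using assms(1) by simp
    also have "\<dots> < 1 / 8"
    proof (rule small)
      have "(m * (3 * N) ^ (m - 1)) * ((s + 1) * (3 * N) ^ s) * card \<J>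
          \<le> (m * (3 * N) ^ (m - 1)) * ((s + 1) * (3 * N) ^ s) * (3 * N)"
        using cJ by (rule mult_le_mono2)
      also have "\<dots> = (m * (s + 1)) * (3 * N) ^ (m - 1 + s + 1)" by (simp add: power_add algebra_simps)
      finally have "real ((m * (3 * N) ^ (m - 1)) * ((s + 1) * (3 * N) ^ s) * card \<J>)
          \<le> real ((m * (s + 1)) * (3 * N) ^ (m - 1 + s + 1))" by (rule of_nat_mono)
      also have "\<dots> \<le> C * real (3 * N) ^ M" by (intro poly) (auto simp: M_def)
      finally show "real ((m * (3 * N) ^ (m - 1)) * ((s + 1) * (3 * N) ^ s) * card \<J>) \<le> C * real (3 * N) ^ M" .
    qed
    finally show ?thesis .
  qed
  moreover have "pr (pairs V) bad3 < 1 / 8"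
  proof -
    have "pr (pairs V) bad3 \<le> ((m + 1) * card V ^ m) * (((s + 1) * card V ^ s) * exp (- (p * real (t * q) / 2)))"
      unfolding bad3_def using pq finV
      by (intro pr_no_triangles_exp) (auto simp: V_def V1_def V2_def V3_def)
    also have "p * real (t * q) = real t" using pq by (simp add: algebra_simps)
    also have "((m + 1) * card V ^ m) * (((s + 1) * card V ^ s) * exp (- (real t / 2)))
        \<le> ((m + 1) * card V ^ m) * (((s + 1) * card V ^ s) * \<epsilon>)"
      unfolding \<epsilon>_def by (intro mult_left_mono) auto
    also have "\<dots> = real (((m + 1) * (s + 1)) * (3 * N) ^ (m + s)) * \<epsilon>"
      unfolding finV by (simp add: power_add algebra_simps)
    also have "\<dots> < 1 / 8" by (intro small poly) (auto simp: M_def)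
    finally show ?thesis .
  qed
  moreover have "pr (pairs V) bad4 < 1 / 8"
  proof -
    have np: "real (card V) * p ^ m = 3 * real t ^ 2"
    proof -
      have "real (card V) * p ^ m = 3 * real t ^ 2 * (p ^ m * real (q ^ m))"
        unfolding finV N_def by simp
      then show ?thesis unfolding pm by simp
    qed
    have "pr (pairs V) bad4 \<le> (real R + 1) * (2 ^ (2 ^ R) * p * (card V * p ^ m) ^ R)"
      unfolding bad4_def
    proof (rule pr_dense[OF finV(1)])
      have "1 \<le> real t ^ 2" using t1 by simp
      then show "1 \<le> real (card V) * p ^ m" unfolding np by linarith
    qed
    \<comment> \<open>This is the reason for the exponent \<open>2 * R + 1\<close> of
      \<open>q\<close>: it outweighs \<open>(t ^ 2) ^ R\<close> by exactly one factor
      \<open>t\<close>.\<close>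
    also have "\<dots> = (real R + 1) * 2 ^ (2 ^ R) * 3 ^ R * (1 / real t)"
    proof -
      have "p * (3 * real t ^ 2) ^ R = 3 ^ R * (1 / real t)"
        unfolding p_def q_def using t1 by (simp add: power_mult_distrib field_simps flip: power_mult)
      then show ?thesis unfolding np by (simp only: mult.assoc)
    qed
    finally show ?thesis using t(1) by linarith
  qed
  moreover have "pr (pairs V) bad5 < 1 / 8"
  proof -
    have pN: "p * real N = real t ^ 2 * real (q ^ (m - 1))"
      using pq unfolding N_def qm by (simp add: algebra_simps)
    have "real t / 4 \<le> real t ^ 2 * real (q ^ (m - 1))"
    proof -
      have "t * 1 \<le> t ^ 2 * q ^ (m - 1)" using t1 q1 by (intro mult_le_mono) (auto simp: power2_eq_square)
      then have "real t \<le> real (t ^ 2 * q ^ (m - 1))" by (metis mult.right_neutral of_nat_mono)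
      then show ?thesis by simp
    qed
    then have exp_le: "exp (- (p * real N)) \<le> \<epsilon>" unfolding \<epsilon>_def pN by simp
    have one: "real (3 * N) * \<epsilon> < 1 / 8"
      using poly[of 1 1] by (intro small) (simp add: M_def)
    have "real (card V) * exp (- (p * real N)) \<le> real (3 * N) * \<epsilon>"
      unfolding finV using exp_le by (intro mult_left_mono) auto
    then have "real (card V) * exp (- (p * real N)) \<le> 1" using one by linarith
    moreover have "3 * k \<le> card V" using finV(3) tN t(3) by linarith
    ultimately have "pr (pairs V) bad5 \<le> ((k + 1) * card V ^ k) * (card V * (card V * exp (- (p * N))))"
      unfolding bad5_def using finV by (intro pr_cuts) auto
    also have "\<dots> \<le> ((k + 1) * card V ^ k) * (card V * (card V * \<epsilon>))"
      using exp_le by (intro mult_left_mono) auto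
    also have "\<dots> = real ((k + 1) * (3 * N) ^ (k + 2)) * \<epsilon>"
      unfolding finV by (simp add: power_add power2_eq_square algebra_simps)
    also have "\<dots> < 1 / 8" by (intro small poly) (auto simp: M_def)
    finally show ?thesis .
  qed
  moreover have "pr (pairs V) (\<lambda>S. bad1 S \<or> (bad2 S \<or> (bad3 S \<or> (bad4 S \<or> bad5 S))))
      \<le> pr (pairs V) bad1 + (pr (pairs V) bad2 + (pr (pairs V) bad3 + (pr (pairs V) bad4 + pr (pairs V) bad5)))"
    by (rule order_trans[OF pr_disj] add_left_mono)+ simp
  ultimately have "pr (pairs V) (\<lambda>S. bad1 S \<or> (bad2 S \<or> (bad3 S \<or> (bad4 S \<or> bad5 S)))) < 1"
    by linarith
  from pr_less_1_exists[OF finite_pairs[OF finV(1)] this]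
  obtain S where S: "S \<subseteq> pairs V" and good: "\<not> bad1 S" "\<not> bad2 S" "\<not> bad3 S" "\<not> bad4 S" "\<not> bad5 S"
    by blast

  have G: "graph V (adj S)" by (rule graph_adj[OF finV(1) S])
  have sub: "V1 \<subseteq> V" "V2 \<subseteq> V" "V3 \<subseteq> V" unfolding V_def V1_def V2_def V3_def by auto
  have ext: "\<exists>z\<in>V3 - (A \<union> B). pattern (adj S) A B z"
    if "A \<subseteq> V" "B \<subseteq> V" "A \<inter> B = {}" "card A \<le> m" "card B \<le> s" for A B
  proof (rule ccontr)
    assume "\<not> ?thesis"
    then have "bad1 S" unfolding bad1_def using that
      by (intro bexI[of _ A] bexI[of _ B] bexI[of _ V3]) auto
    then show False using good(1) by simp
  qed
  have blocks: "\<exists>y\<in>block i l. y \<in> block i l - (A \<union> B) \<and> pattern (adj S) A B y"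
    if "A \<subseteq> V" "B \<subseteq> V" "A \<inter> B = {}" "Suc (card A) = m" "card B \<le> s" "i < 2" "l < t * q" for A B i l
  proof -
    have J: "block i l \<in> \<J>" "card A \<le> m - 1" unfolding \<J>_def using that by auto
    have "\<exists>y\<in>block i l - (A \<union> B). pattern (adj S) A B y"
    proof (rule ccontr)
      assume "\<not> ?thesis"
      then have "bad2 S" unfolding bad2_def using J that(1-3,5)
        by (intro bexI[of _ A] bexI[of _ B] bexI[of _ "block i l"]) auto
      then show False using good(2) by simp
    qed
    then show ?thesis by blast
  qed
  have "robust V (adj S) m s R"
  proof
    show "graph V (adj S)" "1 \<le> m" "R \<le> s" by fact+
    show "\<exists>z\<in>V - (A \<union> B). pattern (adj S) A B z"
      if "A \<subseteq> V" "B \<subseteq> V" "A \<inter> B = {}" "card A \<le> m" "card B \<le> s" for A B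
      using ext[OF that] sub by blast
    show "num_edges U (adj S) \<le> m * card U" if "U \<subseteq> V" "card U \<le> R" for U
      using good(4) that unfolding bad4_def by (simp add: not_less)
    fix X B assume XB: "X \<subseteq> V" "B \<subseteq> V" "X \<inter> B = {}" "Suc (card X) = m" "card B \<le> s"
    have fin: "finite (nbhd S J X B)" if "J \<subseteq> V" for J
      using that finV(1) unfolding nbhd_def by (auto intro: finite_subset)
    have many: "t * q \<le> card (nbhd S {i * N..<i * N + N} X B)" if "i < 2" for i
    proof (rule card_ge_blocks)
      show "finite (nbhd S {i * N..<i * N + N} X B)" by (rule fin[OF part_sub[OF that]])
      fix l assume l: "l < t * q"
      show "\<exists>y\<in>{i * N + l * b..<i * N + (l + 1) * b}. y \<in> nbhd S {i * N..<i * N + N} X B"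
        using blocks[OF XB that l] block_sub[OF l, of i] unfolding nbhd_def block_def by blast
    qed
    have c1: "t * q \<le> card (nbhd S V1 X B)"
      using many[of 0] unfolding V1_def by (simp add: lessThan_atLeast0)
    have "t * q \<le> card (nbhd S V2 X B)"
      using many[of 1] unfolding V2_def by (simp add: mult_2)
    moreover have "1 * q \<le> t * q" using t1 by (rule mult_le_mono1)
    ultimately have c2: "q \<le> card (nbhd S V2 X B)" by linarith
    have finXB: "finite X" using XB finV finite_subset by blast
    \<comment> \<open>Because \<open>Suc (card X) = m\<close>, the set \<open>insert y X\<close> has
      at most \<open>m\<close> elements and is covered by the extension property in
      \<open>V3\<close>.\<close>
    have c3: "\<exists>z\<in>nbhd S V3 X B. adj S y z" if y: "y \<in> nbhd S V2 X B" for y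
    proof -
      have y': "y \<in> V" "y \<notin> X" "y \<notin> B" using y sub unfolding nbhd_def by auto
      have "card (insert y X) \<le> m" using y' XB(4) finXB by simp
      then obtain z where "z \<in> V3 - (insert y X \<union> B)" "pattern (adj S) (insert y X) B z"
        using ext[of "insert y X" B] y' XB by auto
      then show ?thesis unfolding nbhd_def pattern_def by auto
    qed
    have "card X \<le> m" using XB by simp
    obtain w y z where wyz: "w \<in> nbhd S V1 X B" "y \<in> nbhd S V2 X B" "z \<in> nbhd S V3 X B"
        "adj S w y" "adj S w z" "adj S y z"
    proof -
      have "\<exists>w\<in>nbhd S V1 X B. \<exists>y\<in>nbhd S V2 X B. \<exists>z\<in>nbhd S V3 X B. adj S w y \<and> adj S w z \<and> adj S y z"
      proof (rule ccontr)
        assume "\<not> ?thesis"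
        then have "bad3 S" unfolding bad3_def using XB(1,2,5) \<open>card X \<le> m\<close> c1 c2 c3
          by (intro bexI[of _ X] bexI[of _ B] conjI) auto
        then show False using good(3) by simp
      qed
      then show ?thesis using that by blast
    qed
    have "u \<in> V - (X \<union> B) \<and> pattern (adj S) X B u" if "u \<in> nbhd S J X B" "J \<subseteq> V" for u J
      using that unfolding nbhd_def by auto
    then show "\<exists>w\<in>V - (X \<union> B). \<exists>y\<in>V - (X \<union> B). \<exists>z\<in>V - (X \<union> B). adj S w y \<and> adj S w z \<and> adj S y z
        \<and> pattern (adj S) X B w \<and> pattern (adj S) X B y \<and> pattern (adj S) X B z"
      using wyz sub by metis
  qed
  moreover have "k_connected V (adj S) k"
  proof (rule k_connectedI)
    show "finite V" by (rule finV)
    show "k < card V" using finV(3) tN t(3) by simp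
    show "adj S y x" if "adj S x y" for x y using that unfolding adj_def by (simp add: insert_commute)
    fix X T assume *: "X \<subseteq> V" "card X \<le> k" "T \<subseteq> V - X" "T \<noteq> {}" "2 * card T \<le> card (V - X)"
    have TV: "T \<subseteq> V" "T \<inter> X = {}" using * by auto
    have "finite T" using TV finV finite_subset by blast
    then have T: "card T \<in> {1..card V}" using TV * finV card_mono[of V T] by (simp add: Suc_le_eq card_gt_0_iff)
    show "\<exists>x\<in>T. \<exists>y\<in>V - X - T. adj S x y"
    proof (rule ccontr)
      assume "\<not> ?thesis"
      then have "bad5 S" unfolding bad5_def using *(1,2,5) TV T
        by (intro bexI[of _ X] bexI[of _ "card T"] bexI[of _ T] conjI) auto
      then show False using good(5) by simp
    qed
  qed
  moreover have "v \<le> 3 * N" using tN t(3) by simp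
  ultimately show ?thesis unfolding V_def by blast
qed

section \<open>Definability of subgraph containment\<close>

lemma sat_foldr_Conj: "sat V E a (foldr Conj \<phi>s (Eq 0 0)) \<longleftrightarrow> (\<forall>\<phi>\<in>set \<phi>s. sat V E a \<phi>)"
  by (induction \<phi>s) auto

lemma free_vars_foldr_Conj: "free_vars (foldr Conj \<phi>s (Eq 0 0)) = (\<Union>\<phi>\<in>set \<phi>s. free_vars \<phi>) \<union> {0}"
  by (induction \<phi>s) auto

fun exists_below :: "nat \<Rightarrow> fo \<Rightarrow> fo" where
  "exists_below 0 \<phi> = \<phi>"
| "exists_below (Suc n) \<phi> = Ex n (exists_below n \<phi>)"

lemma free_vars_exists_below: "free_vars (exists_below n \<phi>) = free_vars \<phi> - {..<n}"
  by (induction n) (auto simp: lessThan_Suc)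

lemma sat_exists_below:
  "sat V E a (exists_below n \<phi>) \<longleftrightarrow> (\<exists>b. (\<forall>i<n. b i \<in> V) \<and> (\<forall>i\<ge>n. b i = a i) \<and> sat V E b \<phi>)"
proof (induction n arbitrary: a)
  case 0
  have "(\<exists>b. (\<forall>i. b i = a i) \<and> sat V E b \<phi>) \<longleftrightarrow> sat V E a \<phi>"
    by (metis ext)
  then show ?case by simp
next
  case (Suc n)
  show ?case
  proof
    assume "sat V E a (exists_below (Suc n) \<phi>)"
    then obtain v b where "v \<in> V" "\<forall>i<n. b i \<in> V" "\<forall>i\<ge>n. b i = (a(n := v)) i" "sat V E b \<phi>"
      using Suc.IH by auto
    moreover from this have "\<forall>i<Suc n. b i \<in> V" by (auto simp: less_Suc_eq)
    moreover have "\<forall>i\<ge>Suc n. b i = a i" using calculation(3) by auto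
    ultimately show "\<exists>b. (\<forall>i<Suc n. b i \<in> V) \<and> (\<forall>i\<ge>Suc n. b i = a i) \<and> sat V E b \<phi>" by blast
  next
    assume "\<exists>b. (\<forall>i<Suc n. b i \<in> V) \<and> (\<forall>i\<ge>Suc n. b i = a i) \<and> sat V E b \<phi>"
    then obtain b where b: "\<forall>i<Suc n. b i \<in> V" "\<forall>i\<ge>Suc n. b i = a i" "sat V E b \<phi>" by blast
    have "b i = (a(n := b n)) i" if "n \<le> i" for i
      using b(2)[rule_format, of i] that by (cases "i = n") auto
    moreover have "b i \<in> V" if "i < n" for i using b(1) that by simp
    ultimately have "sat V E (a(n := b n)) (exists_below n \<phi>)"
      unfolding Suc.IH using b(3) by blast
    then show "sat V E a (exists_below (Suc n) \<phi>)" using b(1) by auto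
  qed
qed

text \<open>The \<open>LEAST\<close> in \<open>D_kappa\<close> is attained only if some defining
  sentence exists. Existential quantifiers for \<open>card VF\<close> distinct vertices with the
  required edges give one, valid for the connectivity bound 0.\<close>

lemma containment_definable:
  assumes F: "graph VF EF" "VF \<noteq> {}"
  shows "\<exists>\<Phi>. defines_containment_kappa VF EF \<Phi> 0"
proof -
  define v where "v = card VF"
  have finF: "finite VF" using F unfolding graph_def by blast
  have v: "0 < v" unfolding v_def using F finF by (simp add: card_gt_0_iff)
  obtain g where g: "bij_betw g {0..<v} VF"
    using ex_bij_betw_nat_finite[OF finF, folded v_def] by (rule exE)
  define \<Psi> where "\<Psi> = (\<lambda>(i, j). Neg (Eq i j)) ` {(i, j). i < v \<and> j < v \<and> i \<noteq> j}
      \<union> (\<lambda>(i, j). Adj i j) ` {(i, j). i < v \<and> j < v \<and> EF (g i) (g j)}"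
  have "finite {(i, j). i < v \<and> j < v \<and> P i j}" for P
    by (rule finite_subset[of _ "{..<v} \<times> {..<v}"]) auto
  then have "finite \<Psi>"
    unfolding \<Psi>_def by (intro finite_UnI finite_imageI)
  then obtain \<psi>s where \<psi>s: "set \<psi>s = \<Psi>" using finite_list by blast
  \<comment> \<open>\<open>Eq 0 0\<close> closes the conjunction as a true formula; its variable 0
    is bound because \<open>0 < v\<close>.\<close>
  define \<Phi> where "\<Phi> = exists_below v (foldr Conj \<psi>s (Eq 0 0))"
  have "sentence \<Phi>"
    unfolding sentence_def \<Phi>_def free_vars_exists_below free_vars_foldr_Conj \<psi>s \<Psi>_def
    using v by auto
  moreover have "models V E \<Phi> \<longleftrightarrow> contains_subgraph V E VF EF" for V :: "nat set" and E
  proof -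
    have sat: "sat V E a \<Phi> \<longleftrightarrow> (\<exists>b. (\<forall>i<v. b i \<in> V) \<and> (\<forall>i\<ge>v. b i = a i)
        \<and> (\<forall>i<v. \<forall>j<v. i \<noteq> j \<longrightarrow> b i \<noteq> b j) \<and> (\<forall>i<v. \<forall>j<v. EF (g i) (g j) \<longrightarrow> E (b i) (b j)))" for a
    proof -
      have "(\<forall>\<phi>\<in>set \<psi>s. sat V E b \<phi>) \<longleftrightarrow> (\<forall>i<v. \<forall>j<v. i \<noteq> j \<longrightarrow> b i \<noteq> b j)
          \<and> (\<forall>i<v. \<forall>j<v. EF (g i) (g j) \<longrightarrow> E (b i) (b j))" for b
        unfolding \<psi>s \<Psi>_def ball_Un by (simp add: split_beta) blast
      then show ?thesis unfolding \<Phi>_def sat_exists_below sat_foldr_Conj by simp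
    qed
    have gi: "g i \<in> VF" if "i < v" for i using bij_betwE[OF g] that by simp
    have ginj: "i = j" if "i < v" "j < v" "g i = g j" for i j
      using inj_onD[OF bij_betw_imp_inj_on[OF g], of i j] that by simp
    show ?thesis
    proof
      assume "models V E \<Phi>"
      then have "sat V E undefined \<Phi>" unfolding models_def by (rule spec)
      then obtain b where b: "\<forall>i<v. b i \<in> V" "\<forall>i<v. \<forall>j<v. i \<noteq> j \<longrightarrow> b i \<noteq> b j"
        "\<forall>i<v. \<forall>j<v. EF (g i) (g j) \<longrightarrow> E (b i) (b j)"
        unfolding sat by (elim exE conjE)
      define h where "h = the_inv_into {0..<v} g"
      have h: "h x < v" "g (h x) = x" if "x \<in> VF" for x
      proof -
        have "x \<in> g ` {0..<v}" "inj_on g {0..<v}" using g that unfolding bij_betw_def by auto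
        then have "h x \<in> {0..<v}" "g (h x) = x"
          unfolding h_def by (auto intro: the_inv_into_into f_the_inv_into_f simp del: atLeastLessThan_iff)
        then show "h x < v" "g (h x) = x" by auto
      qed
      have "inj_on (b \<circ> h) VF"
      proof (rule inj_onI)
        fix x y assume "x \<in> VF" "y \<in> VF" "(b \<circ> h) x = (b \<circ> h) y"
        then show "x = y" using b(2) h[of x] h[of y] by (metis comp_apply)
      qed
      moreover have "(b \<circ> h) ` VF \<subseteq> V" using b(1) h by auto
      moreover have "E ((b \<circ> h) x) ((b \<circ> h) y)" if "EF x y" for x y
      proof -
        have "x \<in> VF" "y \<in> VF" using F(1) that unfolding graph_def by blast+
        then show ?thesis using b(3) h[of x] h[of y] that by simp
      qed
      ultimately show "contains_subgraph V E VF EF" unfolding contains_subgraph_def by blast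
    next
      assume "contains_subgraph V E VF EF"
      then obtain f where f: "inj_on f VF" "f ` VF \<subseteq> V" "\<forall>x y. EF x y \<longrightarrow> E (f x) (f y)"
        unfolding contains_subgraph_def by blast
      have "sat V E a \<Phi>" for a
        unfolding sat
      proof (intro exI[of _ "\<lambda>i. if i < v then f (g i) else a i"] conjI allI impI)
        fix i j assume "i < v" "j < v" "i \<noteq> j"
        then show "(if i < v then f (g i) else a i) \<noteq> (if j < v then f (g j) else a j)"
          using inj_onD[OF f(1), of "g i" "g j"] gi[of i] gi[of j] ginj[of i j] by auto
      qed (use f gi in auto)
      then show "models V E \<Phi>" unfolding models_def by blast
    qed
  qed
  ultimately have "defines_containment_kappa VF EF \<Phi> 0"
    unfolding defines_containment_kappa_def by simp
  then show ?thesis by blast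
qed

section \<open>Lower bound on the quantifier depth\<close>

lemma num_edges_subgraph_le:
  assumes "graph VF EF" "finite V" "inj_on f VF" "f ` VF \<subseteq> V" "\<And>x y. EF x y \<Longrightarrow> E (f x) (f y)"
  shows "num_edges VF EF \<le> num_edges (f ` VF) E"
proof -
  let ?S = "{{x, y} |x y. x \<in> VF \<and> y \<in> VF \<and> EF x y}"
  let ?T = "{{x, y} |x y. x \<in> f ` VF \<and> y \<in> f ` VF \<and> E x y}"
  have "inj_on ((`) f) ?S"
    by (rule inj_on_subset[OF inj_on_image_Pow[OF assms(3)]]) auto
  moreover have "(`) f ` ?S \<subseteq> ?T"
  proof
    fix e assume "e \<in> (`) f ` ?S"
    then obtain x y where "e = {f x, f y}" "x \<in> VF" "y \<in> VF" "EF x y" by auto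
    then show "e \<in> ?T" using assms(5)[of x y] by blast
  qed
  moreover have "finite (f ` VF)" using assms(2,4) finite_subset by blast
  then have "finite ?T" by (rule finite_edge_set)
  ultimately show ?thesis unfolding num_edges_def by (rule card_inj_on_le)
qed

lemma k_connected_mono:
  assumes "k_connected V E k" "\<And>x y. E x y \<Longrightarrow> E' x y"
  shows "k_connected V E' k"
proof -
  have "connected_graph U E'" if "connected_graph U E" for U
  proof -
    have "(\<lambda>x y. x \<in> U \<and> y \<in> U \<and> E x y) \<le> (\<lambda>x y. x \<in> U \<and> y \<in> U \<and> E' x y)"
      using assms(2) by auto
    then have "(\<lambda>x y. x \<in> U \<and> y \<in> U \<and> E x y)\<^sup>*\<^sup>* \<le> (\<lambda>x y. x \<in> U \<and> y \<in> U \<and> E' x y)\<^sup>*\<^sup>*"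
      by (rule rtranclp_mono)
    then show ?thesis using that unfolding connected_graph_def by auto
  qed
  then show ?thesis using assms(1) unfolding k_connected_def by auto
qed

lemma qdepth_gt:
  fixes VF :: "'a set"
  assumes F: "graph VF EF" and m: "1 \<le> m" "m * num_vertices VF < num_edges VF EF"
    and \<Phi>: "defines_containment_kappa VF EF \<Phi> k"
  shows "m + 2 < qdepth \<Phi>"
proof (rule ccontr)
  assume depth: "\<not> m + 2 < qdepth \<Phi>"
  have finF: "finite VF" using F unfolding graph_def by blast
  define v where "v = card VF"
  \<comment> \<open>The range of sparseness demanded by \<open>rich_superposition\<close>. It is at
    least \<open>v\<close>, so sparseness also applies to the image of a hypothetical copy of
    \<open>F\<close>.\<close>
  define R where "R = (v + 2 * m) + 3 * (m * (v + 2 * m) + 1)"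
  obtain n E where H: "robust {..<n} E m R R" "k_connected {..<n} E k" "v \<le> n"
    using robust_graph_exists[OF m(1), of R R k v] by auto
  interpret robust "{..<n}" E m R R by fact
  obtain h where h: "bij_betw h VF {0..<v}"
    using ex_bij_betw_finite_nat[OF finF, folded v_def] by (rule exE)
  have hinj: "inj_on h VF" and hW: "h ` VF = {..<v}"
    using h unfolding bij_betw_def by (auto simp: lessThan_atLeast0)
  define E' where "E' x y \<longleftrightarrow> E x y \<or> (\<exists>a b. EF a b \<and> x = h a \<and> y = h b)" for x y
  have EF: "EF a b \<Longrightarrow> a \<in> VF \<and> b \<in> VF \<and> EF b a \<and> a \<noteq> b" for a b
    using F unfolding graph_def by blast
  have planted: "x < v \<and> y < v \<and> x \<noteq> y" if ab: "EF a b" "x = h a" "y = h b" for a b x y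
    using EF[OF ab(1)] ab(2,3) hW hinj by (auto dest: inj_onD)
  have graph': "graph {..<n} E'"
    unfolding graph_def
  proof (intro conjI allI impI)
    fix x y assume xy: "E' x y"
    then show "x \<in> {..<n}" "y \<in> {..<n}"
      unfolding E'_def using EV[of x y] planted H(3) by (fastforce, fastforce)
    show "E' y x" using xy sym[of x y] EF unfolding E'_def by blast
  next
    fix x show "\<not> E' x x" unfolding E'_def using irr planted by blast
  qed simp
  \<comment> \<open>Both graphs are instances of one lemma: nothing planted, with \<open>W\<close>
    empty, and \<open>F\<close> planted on the first \<open>v\<close> vertices.\<close>
  have "rich {..<n} E m"
    by (rule rich_superposition[of E "{}" v]) (use graph R_def in auto)
  moreover have "rich {..<n} E' m"
    by (rule rich_superposition[of E' "{..<v}" v])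
      (use graph' R_def H(3) planted in \<open>auto simp: E'_def\<close>)
  ultimately have "models {..<n} E \<Phi> \<longleftrightarrow> models {..<n} E' \<Phi>"
    by (rule rich_equivalent) (use \<Phi> depth in \<open>auto simp: defines_containment_kappa_def\<close>)
  moreover have "models {..<n} E \<Phi> \<longleftrightarrow> contains_subgraph {..<n} E VF EF"
    using \<Phi> graph H(2) kappa_ge[OF H(2)] unfolding defines_containment_kappa_def k_connected_def by blast
  moreover have k': "k_connected {..<n} E' k"
    by (rule k_connected_mono[OF H(2)]) (simp add: E'_def)
  have "models {..<n} E' \<Phi> \<longleftrightarrow> contains_subgraph {..<n} E' VF EF"
    using \<Phi> graph' k' kappa_ge[OF k'] unfolding defines_containment_kappa_def k_connected_def by blast
  moreover have "contains_subgraph {..<n} E' VF EF"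
    unfolding contains_subgraph_def using hinj hW H(3)
    by (intro exI[of _ h]) (auto simp: E'_def)
  ultimately have "contains_subgraph {..<n} E VF EF" by simp
  then obtain f where f: "inj_on f VF" "f ` VF \<subseteq> {..<n}" "\<And>x y. EF x y \<Longrightarrow> E (f x) (f y)"
    unfolding contains_subgraph_def by blast
  have "card (f ` VF) = v" unfolding v_def using f(1) by (rule card_image)
  then have "num_edges (f ` VF) E \<le> m * v" using sparse[OF f(2)] R_def by simp
  moreover have "num_edges VF EF \<le> num_edges (f ` VF) E"
    using f by (intro num_edges_subgraph_le[OF F, of "{..<n}"]) auto
  ultimately show False using m(2) unfolding num_vertices_def v_def by simp
qed

theorem theorem12:
  fixes VF :: "'a set" and EF :: "'a \<Rightarrow> 'a \<Rightarrow> bool"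
  assumes "graph VF EF"
    and "connected_graph VF EF"
    and "num_edges VF EF > num_vertices VF"
  shows "real (D_kappa VF EF) \<ge> real (num_edges VF EF) / real (num_vertices VF) + 2"
proof -
  define v where "v = num_vertices VF"
  define e where "e = num_edges VF EF"
  \<comment> \<open>Subtracting 1 before dividing keeps \<open>m * v < e\<close> strict even when
    \<open>v\<close> divides \<open>e\<close>, while still \<open>e \<le> (m + 1) * v\<close>. The
    strict bound \<open>m + 2 < D_kappa VF EF\<close> then gives \<open>m + 3\<close>, which is at
    least \<open>e / v + 2\<close>.\<close>
  define m where "m = (e - 1) div v"
  have "VF \<noteq> {}" "finite VF" using assms unfolding connected_graph_def graph_def by auto
  then have v: "0 < v" unfolding v_def num_vertices_def by (simp add: card_gt_0_iff)
  have ev: "v < e" using assms(3) unfolding v_def e_def by simp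
  have m: "1 \<le> m" unfolding m_def using ev v by (simp add: Suc_le_eq div_greater_zero_iff)
  have "m * v \<le> e - 1" unfolding m_def by (rule div_times_less_eq_dividend)
  then have mv: "m * v < e" using ev by linarith
  have "e - 1 < (m + 1) * v" unfolding m_def using v
    by (metis Suc_eq_plus1 dividend_less_div_times mult.commute mult_Suc)
  then have e_le: "e \<le> (m + 1) * v" by linarith
  obtain \<Phi>0 where "defines_containment_kappa VF EF \<Phi>0 0"
    using containment_definable[OF assms(1) \<open>VF \<noteq> {}\<close>] by blast
  then have "\<exists>d \<Phi> k. qdepth \<Phi> = d \<and> defines_containment_kappa VF EF \<Phi> k" by blast
  then obtain \<Phi> k where \<Phi>: "qdepth \<Phi> = D_kappa VF EF" "defines_containment_kappa VF EF \<Phi> k"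
    unfolding D_kappa_def using LeastI_ex[of "\<lambda>d. \<exists>\<Phi> k. qdepth \<Phi> = d \<and> defines_containment_kappa VF EF \<Phi> k"] by blast
  have "m + 2 < D_kappa VF EF"
    using qdepth_gt[OF assms(1) m _ \<Phi>(2)] mv \<Phi>(1) unfolding v_def e_def by simp
  then have D: "real m + 3 \<le> real (D_kappa VF EF)" by linarith
  have "real e \<le> real ((m + 1) * v)" using e_le by (rule of_nat_mono)
  then have "real e / real v \<le> real m + 1" using v by (simp add: field_simps)
  then show ?thesis using D unfolding v_def e_def by linarith
qed

end
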